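(* Let $G=(A,B,E)$ be a connected bipartite graph with $|A|\ge 2$ and $|B|\ge 2$. Then $$\mathcal{B}(G)=\eta(G)=\max\Big\{\max_{u\in G}\big(\mathcal{D}(u,G)+\mathcal{C}(G)-2\big),\ \mathcal{M}(\Lambda(G))+\mathcal{R}(\Lambda(G))\Big\}.$$
   Context: All graphs are finite and undirected, with no self-loops and no multiple edges. $G=(A,B,E)$ is a bipartite graph with vertex classes $A$ and $B$, so every edge joins a vertex of $A$ to a vertex of $B$. Two vertices $x,y$ are biconnected if they lie in the same connected component and still lie in the same connected component after deleting any single edge, or any single vertex other than $x$ and $y$. A vertex set is biconnected if every pair of its distinct vertices is biconnected. Consequently a single vertex is a biconnected set, while the two endpoints of an edge whose removal disconnects them are not biconnected. A block of $G$ is the induced subgraph on a maximal biconnected vertex set; it is singular if it has exactly one vertex. $G$ is componentwise biconnected if every connected component of $G$ is a block. Thus isolated vertices are allowed, but a component consisting of a single edge is not a block. A legal edge is a pair $(a,b)\in A\times B$ with $(a,b)\notin E$. A biconnector of $G$ is a set $L$ of legal edges such that $(A,B,E\cup L)$ is componentwise biconnected. $\mathcal{B}(G)$ denotes the minimum number of edges in a biconnector of $G$. A cut vertex is a vertex whose removal increases the number of connected components. A pendant block is either a singular block consisting of a vertex of degree $1$, or a nonsingular block containing exactly one cut vertex of $G$. $\Lambda(G)$ is the set of pendant blocks of $G$. A block is of type $A$ (resp. type $B$) if all of its non-cut vertices lie in $A$ (resp. $B$). It is of type $AB$ if it has at least one non-cut vertex in $A$ and at least one in $B$. A legal pair is an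 unordered pair of two distinct pendant blocks whose types are $\{A,B\}$, $\{A,AB\}$, $\{B,AB\}$ or $\{AB,AB\}$. For $\Lambda'\subseteq\Lambda(G)$, a legal matching of $\Lambda'$ is a set of legal pairs of elements of $\Lambda'$ in which each element of $\Lambda'$ lies in at most one pair. $\mathcal{M}(\Lambda')$ is the maximum cardinality of a legal matching of $\Lambda'$, and $\mathcal{R}(\Lambda')=|\Lambda'|-2\mathcal{M}(\Lambda')$. For a vertex $u$, $\mathcal{D}(u,G)$ is the number of connected components of $X-\{u\}$, where $X$ is the connected component of $G$ containing $u$. $\mathcal{C}(G)$ is the number of connected components of $G$ that are not blocks. *)

theory Defs
  imports Main
begin

text \<open>
  An undirected graph is given by a vertex set \<open>V\<close> and a set \<open>E\<close> of pairs in which every edge is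
  listed once, in one of its two orientations; for a bipartite graph \<open>(A, B, E)\<close> this is the
  orientation from \<open>A\<close> to \<open>B\<close>. Only edges with both ends in \<open>V\<close> count, so \<open>V - {v}\<close> together with
  the unchanged \<open>E\<close> describes the deletion of the vertex \<open>v\<close>. Induced subgraphs (connected
  components, blocks) are represented by their vertex sets.
\<close>

definition adj :: "'a set \<Rightarrow> ('a \<times> 'a) set \<Rightarrow> ('a \<times> 'a) set" where
  "adj V E = {(x, y). x \<in> V \<and> y \<in> V \<and> ((x, y) \<in> E \<or> (y, x) \<in> E)}"

definition conn :: "'a set \<Rightarrow> ('a \<times> 'a) set \<Rightarrow> ('a \<times> 'a) set" where
  "conn V E = {(x, y). x \<in> V \<and> y \<in> V \<and> (x, y) \<in> (adj V E)\<^sup>*}"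

definition components :: "'a set \<Rightarrow> ('a \<times> 'a) set \<Rightarrow> 'a set set" where
  "components V E = V // conn V E"

definition connected_graph :: "'a set \<Rightarrow> ('a \<times> 'a) set \<Rightarrow> bool" where
  "connected_graph V E \<longleftrightarrow> V \<noteq> {} \<and> (\<forall>x\<in>V. \<forall>y\<in>V. (x, y) \<in> conn V E)"

definition degree :: "'a set \<Rightarrow> ('a \<times> 'a) set \<Rightarrow> 'a \<Rightarrow> nat" where
  "degree V E v = card {w. (v, w) \<in> adj V E}"

definition cut_vertex :: "'a set \<Rightarrow> ('a \<times> 'a) set \<Rightarrow> 'a \<Rightarrow> bool" where
  "cut_vertex V E v \<longleftrightarrow> v \<in> V \<and> card (components (V - {v}) E) > card (components V E)"

definition biconnected :: "'a set \<Rightarrow> ('a \<times> 'a) set \<Rightarrow> 'a \<Rightarrow> 'a \<Rightarrow> bool" where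
  "biconnected V E x y \<longleftrightarrow>
     (x, y) \<in> conn V E \<and>
     (\<forall>e\<in>E. (x, y) \<in> conn V (E - {e})) \<and>
     (\<forall>v\<in>V - {x, y}. (x, y) \<in> conn (V - {v}) E)"

definition biconnected_set :: "'a set \<Rightarrow> ('a \<times> 'a) set \<Rightarrow> 'a set \<Rightarrow> bool" where
  "biconnected_set V E S \<longleftrightarrow>
     S \<subseteq> V \<and> (\<forall>x\<in>S. \<forall>y\<in>S. x \<noteq> y \<longrightarrow> biconnected V E x y)"

definition block :: "'a set \<Rightarrow> ('a \<times> 'a) set \<Rightarrow> 'a set \<Rightarrow> bool" where
  "block V E S \<longleftrightarrow>
     S \<noteq> {} \<and> biconnected_set V E S \<and> (\<forall>T. biconnected_set V E T \<and> S \<subseteq> T \<longrightarrow> T = S)"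

definition componentwise_biconnected :: "'a set \<Rightarrow> ('a \<times> 'a) set \<Rightarrow> bool" where
  "componentwise_biconnected V E \<longleftrightarrow> (\<forall>X\<in>components V E. block V E X)"

definition pendant_block :: "'a set \<Rightarrow> ('a \<times> 'a) set \<Rightarrow> 'a set \<Rightarrow> bool" where
  "pendant_block V E S \<longleftrightarrow>
     block V E S \<and>
     ((\<exists>v. S = {v} \<and> degree V E v = 1) \<or>
      (card S \<noteq> 1 \<and> (\<exists>!v. v \<in> S \<and> cut_vertex V E v)))"

definition bipartite_graph :: "'a set \<Rightarrow> 'a set \<Rightarrow> ('a \<times> 'a) set \<Rightarrow> bool" where
  "bipartite_graph A B E \<longleftrightarrow> finite A \<and> finite B \<and> A \<inter> B = {} \<and> E \<subseteq> A \<times> B"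

definition biconnector :: "'a set \<Rightarrow> 'a set \<Rightarrow> ('a \<times> 'a) set \<Rightarrow> ('a \<times> 'a) set \<Rightarrow> bool" where
  "biconnector A B E L \<longleftrightarrow>
     L \<subseteq> A \<times> B - E \<and> componentwise_biconnected (A \<union> B) (E \<union> L)"

text \<open>
  \<open>LEAST\<close> leaves the value unspecified if there is no biconnector at all (which happens, e.g., for
  a single edge); a connected graph with two vertices on each side always has one, namely the set
  of all legal edges.
\<close>

definition min_biconnector_size :: "'a set \<Rightarrow> 'a set \<Rightarrow> ('a \<times> 'a) set \<Rightarrow> nat" where
  "min_biconnector_size A B E = (LEAST k. \<exists>L. biconnector A B E L \<and> card L = k)"

definition pendant_blocks :: "'a set \<Rightarrow> 'a set \<Rightarrow> ('a \<times> 'a) set \<Rightarrow> 'a set set" where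
  "pendant_blocks A B E = {S. pendant_block (A \<union> B) E S}"

definition non_cut :: "'a set \<Rightarrow> 'a set \<Rightarrow> ('a \<times> 'a) set \<Rightarrow> 'a set \<Rightarrow> 'a set" where
  "non_cut A B E S = {v \<in> S. \<not> cut_vertex (A \<union> B) E v}"

definition type_A :: "'a set \<Rightarrow> 'a set \<Rightarrow> ('a \<times> 'a) set \<Rightarrow> 'a set \<Rightarrow> bool" where
  "type_A A B E S \<longleftrightarrow> non_cut A B E S \<subseteq> A"

definition type_B :: "'a set \<Rightarrow> 'a set \<Rightarrow> ('a \<times> 'a) set \<Rightarrow> 'a set \<Rightarrow> bool" where
  "type_B A B E S \<longleftrightarrow> non_cut A B E S \<subseteq> B"

definition type_AB :: "'a set \<Rightarrow> 'a set \<Rightarrow> ('a \<times> 'a) set \<Rightarrow> 'a set \<Rightarrow> bool" where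
  "type_AB A B E S \<longleftrightarrow> non_cut A B E S \<inter> A \<noteq> {} \<and> non_cut A B E S \<inter> B \<noteq> {}"

definition legal_pairs :: "'a set \<Rightarrow> 'a set \<Rightarrow> ('a \<times> 'a) set \<Rightarrow> 'a set set set" where
  "legal_pairs A B E =
     {{S, T} |S T. S \<in> pendant_blocks A B E \<and> T \<in> pendant_blocks A B E \<and> S \<noteq> T \<and>
        (type_A A B E S \<and> type_B A B E T \<or>
         type_A A B E S \<and> type_AB A B E T \<or>
         type_B A B E S \<and> type_AB A B E T \<or>
         type_AB A B E S \<and> type_AB A B E T)}"

definition legal_matching ::
  "'a set \<Rightarrow> 'a set \<Rightarrow> ('a \<times> 'a) set \<Rightarrow> 'a set set \<Rightarrow> 'a set set set \<Rightarrow> bool" where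
  "legal_matching A B E \<Lambda> M \<longleftrightarrow>
     M \<subseteq> legal_pairs A B E \<and> (\<forall>p\<in>M. p \<subseteq> \<Lambda>) \<and>
     (\<forall>S\<in>\<Lambda>. \<forall>p\<in>M. \<forall>q\<in>M. S \<in> p \<and> S \<in> q \<longrightarrow> p = q)"

definition matching_number ::
  "'a set \<Rightarrow> 'a set \<Rightarrow> ('a \<times> 'a) set \<Rightarrow> 'a set set \<Rightarrow> nat" where
  "matching_number A B E \<Lambda> = Max {card M |M. legal_matching A B E \<Lambda> M}"

definition residue ::
  "'a set \<Rightarrow> 'a set \<Rightarrow> ('a \<times> 'a) set \<Rightarrow> 'a set set \<Rightarrow> int" where
  "residue A B E \<Lambda> = int (card \<Lambda>) - 2 * int (matching_number A B E \<Lambda>)"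

definition vertex_split :: "'a set \<Rightarrow> ('a \<times> 'a) set \<Rightarrow> 'a \<Rightarrow> nat" where
  "vertex_split V E u = card (components (conn V E `` {u} - {u}) E)"

definition non_block_components :: "'a set \<Rightarrow> ('a \<times> 'a) set \<Rightarrow> nat" where
  "non_block_components V E = card {X \<in> components V E. \<not> block V E X}"

text \<open>
  Integers are needed because the first maximum is \<open>-1\<close> when the graph is biconnected.
\<close>

definition eta :: "'a set \<Rightarrow> 'a set \<Rightarrow> ('a \<times> 'a) set \<Rightarrow> int" where
  "eta A B E =
     max (MAX u\<in>A \<union> B. int (vertex_split (A \<union> B) E u) + int (non_block_components (A \<union> B) E) - 2)
         (int (matching_number A B E (pendant_blocks A B E)) + residue A B E (pendant_blocks A B E))"

end

theory Submission
  imports Defs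
begin

text \<open>
  A connected graph on at least three vertices is a block iff no vertex separates it, so a biconnector
  is a set \<open>L\<close> of legal edges that reconnects \<open>V - {u}\<close> for every vertex \<open>u\<close>.

  Lower bound. Reconnecting \<open>V - {u}\<close> takes \<open>\<D>(u, G) - 1\<close> edges. Moreover, every pendant block
  has a private vertex at which an edge of \<open>L\<close> ends; the edges serving two pendant blocks form a legal
  matching, whence \<open>|\<Lambda>| \<le> |L| + \<M>(\<Lambda>)\<close>.

  Upper bound. A maximum legal matching gives a family of \<open>\<eta>(G)\<close> pairs in \<open>A \<times> B\<close> with an end in every
  pendant block; among such families take one that connects as many pairs of vertices as possible, summed
  over all deletions \<open>V - {u}\<close>. Suppose that some \<open>V - {u}\<close> stays disconnected. If an edge \<open>xu\<close> of the
  family can be replaced by \<open>xw\<close> with \<open>w\<close> in another component of \<open>V - {u}\<close>, this connects more.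
  If not, no edge of the family ends in \<open>u\<close>, and as the family has at least \<open>\<D>(u, G) - 1\<close> edges, some edge
  \<open>xx'\<close> is redundant in \<open>V - {u}\<close>; another component contains part of a pendant block and hence an edge
  \<open>yy'\<close> of the family, and exchanging the two for \<open>xy'\<close> and \<open>yx'\<close> connects more. Neither exchange does
  harm at a vertex \<open>v \<noteq> u\<close>, since every vertex in a component of \<open>V - {u}\<close> not containing \<open>v\<close> is
  joined to \<open>u\<close> without passing \<open>v\<close>. Pairs that are edges of \<open>G\<close> already, or coincide, only make
  the biconnector smaller.
\<close>

section \<open>Connectivity\<close>

lemma conn_in: "(x, y) \<in> conn V E \<Longrightarrow> x \<in> V \<and> y \<in> V"
  by (auto simp: conn_def)

lemma conn_refl: "x \<in> V \<Longrightarrow> (x, x) \<in> conn V E"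
  by (auto simp: conn_def)

lemma conn_sym: "(x, y) \<in> conn V E \<Longrightarrow> (y, x) \<in> conn V E"
proof -
  have "sym (adj V E)"
    by (auto simp: sym_def adj_def)
  then have "sym ((adj V E)\<^sup>*)"
    by (rule sym_rtrancl)
  then show "(x, y) \<in> conn V E \<Longrightarrow> (y, x) \<in> conn V E"
    by (auto simp: conn_def dest: symD)
qed

lemma conn_trans: "(x, y) \<in> conn V E \<Longrightarrow> (y, z) \<in> conn V E \<Longrightarrow> (x, z) \<in> conn V E"
  by (auto simp: conn_def)

lemma conn_edge: "x \<in> V \<Longrightarrow> y \<in> V \<Longrightarrow> (x, y) \<in> E \<or> (y, x) \<in> E \<Longrightarrow> (x, y) \<in> conn V E"
  by (auto simp: conn_def adj_def)

lemma conn_mono: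
  assumes "V \<subseteq> V'" "E \<subseteq> E'" "(x, y) \<in> conn V E"
  shows "(x, y) \<in> conn V' E'"
proof -
  have "adj V E \<subseteq> adj V' E'"
    using assms by (auto simp: adj_def)
  then have "(adj V E)\<^sup>* \<subseteq> (adj V' E')\<^sup>*"
    by (rule rtrancl_mono)
  then show ?thesis
    using assms by (auto simp: conn_def)
qed

lemma conn_induct [consumes 1, case_names base step]:
  assumes "(x, y) \<in> conn V E" and "P x"
    and step: "\<And>z w. (x, z) \<in> conn V E \<Longrightarrow> P z \<Longrightarrow> z \<in> V \<Longrightarrow> w \<in> V \<Longrightarrow>
                 (z, w) \<in> E \<or> (w, z) \<in> E \<Longrightarrow> P w"
  shows "P y"
proof -
  have x: "x \<in> V" and xy: "(x, y) \<in> (adj V E)\<^sup>*"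
    using assms(1) by (auto simp: conn_def)
  from xy have "(x, y) \<in> conn V E \<and> P y"
  proof induction
    case base
    then show ?case using x assms(2) by (auto intro: conn_refl)
  next
    case (step z w)
    then have "z \<in> V" "w \<in> V" "(z, w) \<in> E \<or> (w, z) \<in> E"
      by (auto simp: adj_def)
    then show ?case
      using step.IH assms(3)[of z w] conn_edge[of z V w E] conn_trans[of x z V E w] by blast
  qed
  then show ?thesis by simp
qed

lemma conn_closed:
  assumes "(x, y) \<in> conn V E" "x \<in> S"
    and "\<And>a b. a \<in> S \<Longrightarrow> a \<in> V \<Longrightarrow> b \<in> V \<Longrightarrow> (a, b) \<in> E \<or> (b, a) \<in> E \<Longrightarrow> b \<in> S"
  shows "y \<in> S"
  using assms(1)
proof (induction rule: conn_induct)
  case base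
  show ?case by (rule assms(2))
next
  case (step z w)
  show ?case by (rule assms(3)[OF step(5,2-4)])
qed

text \<open>A walk from \<open>x\<close> never leaves the component of \<open>x\<close>, so only the
  edges inside that component have to survive the passage to \<open>V'\<close> and
  \<open>E'\<close>.\<close>

lemma conn_within:
  assumes "(x, y) \<in> conn V E" "x \<in> V'"
    and "\<And>a b. (x, a) \<in> conn V E \<Longrightarrow> (x, b) \<in> conn V E \<Longrightarrow> (a, b) \<in> E \<Longrightarrow>
           a \<in> V' \<and> b \<in> V' \<and> (a, b) \<in> E'"
  shows "(x, y) \<in> conn V' E'"
  using assms(1)
proof (induction rule: conn_induct)
  case base
  then show ?case using assms(2) by (rule conn_refl)
next
  case (step z w)
  have "(x, w) \<in> conn V E"
    by (rule conn_trans[OF step(1) conn_edge[OF step(2-4)]])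
  then have "z \<in> V' \<and> w \<in> V' \<and> ((z, w) \<in> E' \<or> (w, z) \<in> E')"
    using step assms(3)[of z w] assms(3)[of w z] by blast
  then show ?case
    using step.IH conn_edge[of z V' w E'] conn_trans[of x z V' E' w] by blast
qed

text \<open>Each lost edge may be replaced by a detour. The exchange arguments rest on this: only
  the removed edges need one.\<close>

lemma conn_subset:
  assumes "(x, y) \<in> conn V E"
    and "\<And>a b. a \<in> V \<Longrightarrow> b \<in> V \<Longrightarrow> (a, b) \<in> E \<Longrightarrow> (a, b) \<in> conn V E'"
  shows "(x, y) \<in> conn V E'"
  using assms(1)
proof (induction rule: conn_induct)
  case base
  then show ?case using assms(1) conn_in conn_refl by metis
next
  case (step z w)
  then have "(z, w) \<in> conn V E'"
    using assms(2)[of z w] assms(2)[of w z] conn_sym[of w z V E'] by blast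
  then show ?case using step.IH conn_trans by metis
qed

text \<open>Up to its first visit to \<open>u\<close>, a walk from \<open>x\<close> stays in the
  component of \<open>x\<close> in \<open>V - {u}\<close>, which does not contain \<open>v\<close>.
  This is why the exchanges do no harm at other vertices.\<close>

lemma conn_via_deleted:
  assumes "(x, u) \<in> conn V E" "x \<noteq> u" "v \<noteq> u" "(x, v) \<notin> conn (V - {u}) E"
  shows "(x, u) \<in> conn (V - {v}) E"
proof -
  have xV: "x \<in> V" "u \<in> V"
    using assms(1) conn_in by metis+
  have xv: "x \<noteq> v"
    using assms xV conn_refl[of x "V - {u}" E] by auto
  have in_comp: "(x, z) \<in> conn (V - {v}) E" if "(x, z) \<in> conn (V - {u}) E" for z
    using that
  proof (rule conn_within)
    show "x \<in> V - {v}" using xV xv by simp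
    fix a b assume "(x, a) \<in> conn (V - {u}) E" "(x, b) \<in> conn (V - {u}) E" "(a, b) \<in> E"
    then show "a \<in> V - {v} \<and> b \<in> V - {v} \<and> (a, b) \<in> E"
      using assms(4) conn_in[of x _ "V - {u}" E] by blast
  qed
  \<comment> \<open>Invariant of the walk: either \<open>u\<close> has been reached without
    \<open>v\<close>, or the current vertex is reachable without \<open>u\<close>. At the final
    vertex \<open>u\<close> the second alternative is impossible.\<close>
  have "(x, u) \<in> conn (V - {v}) E \<or> (x, u) \<in> conn (V - {u}) E"
    using assms(1)
  proof (induction rule: conn_induct[where P = "\<lambda>z. (x, u) \<in> conn (V - {v}) E \<or> (x, z) \<in> conn (V - {u}) E"])
    case base
    then show ?case using xV assms(2) by (auto intro: conn_refl)
  next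
    case (step z w)
    show ?case
    proof (cases "(x, u) \<in> conn (V - {v}) E")
      case False
      then have z: "(x, z) \<in> conn (V - {u}) E"
        using step.IH by blast
      show ?thesis
      proof (cases "w = u")
        case True
        have xz: "(x, z) \<in> conn (V - {v}) E"
          using z by (rule in_comp)
        then have "(z, u) \<in> conn (V - {v}) E"
          using conn_in[OF xz] xV assms(3) step.hyps True by (intro conn_edge) auto
        then show ?thesis using xz conn_trans by metis
      next
        case False
        then have "(z, w) \<in> conn (V - {u}) E"
          using conn_in[OF z] step.hyps by (intro conn_edge) auto
        then show ?thesis using z conn_trans by metis
      qed
    qed auto
  qed
  then show ?thesis
    using conn_in[of x u "V - {u}" E] by blast
qed

section \<open>Counting components\<close>

lemma components_image: "components V E = (\<lambda>x. conn V E `` {x}) ` V"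
  by (auto simp: components_def quotient_def)

lemma finite_components: "finite V \<Longrightarrow> finite (components V E)"
  by (simp add: components_image)

lemma conn_class_eq_iff:
  assumes "x \<in> V" "y \<in> V"
  shows "conn V E `` {x} = conn V E `` {y} \<longleftrightarrow> (x, y) \<in> conn V E"
proof
  assume "conn V E `` {x} = conn V E `` {y}"
  then have "y \<in> conn V E `` {x}"
    using conn_refl[OF assms(2)] by auto
  then show "(x, y) \<in> conn V E" by simp
next
  assume xy: "(x, y) \<in> conn V E"
  have "(x, z) \<in> conn V E \<longleftrightarrow> (y, z) \<in> conn V E" for z
    using conn_trans[OF xy, of z] conn_trans[OF conn_sym[OF xy], of z] by blast
  then show "conn V E `` {x} = conn V E `` {y}" by auto
qed

lemma card_components_le_1_iff:
  assumes "finite V"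
  shows "card (components V E) \<le> 1 \<longleftrightarrow> (\<forall>x\<in>V. \<forall>y\<in>V. (x, y) \<in> conn V E)"
proof -
  have "card (components V E) \<le> 1 \<longleftrightarrow> (\<forall>C\<in>components V E. \<forall>D\<in>components V E. C = D)"
    using card_le_Suc0_iff_eq[OF finite_components[OF assms]] by simp
  also have "\<dots> \<longleftrightarrow> (\<forall>x\<in>V. \<forall>y\<in>V. (x, y) \<in> conn V E)"
    by (simp add: components_image conn_class_eq_iff)
  finally show ?thesis .
qed

lemma conn_image_class:
  assumes "F \<subseteq> F'" "a \<in> V"
  shows "conn V F' `` (conn V F `` {a}) = conn V F' `` {a}"
proof
  show "conn V F' `` (conn V F `` {a}) \<subseteq> conn V F' `` {a}"
    using conn_mono[OF order_refl assms(1), of a] conn_trans[of a _ V F'] by blast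
  show "conn V F' `` {a} \<subseteq> conn V F' `` (conn V F `` {a})"
    using conn_refl[OF assms(2), of F] by blast
qed

text \<open>Enlarging the edge set merges components, and the map from old to new ones is onto. The
  counts that follow ask where it fails to be injective.\<close>

lemma components_image_mono:
  assumes "F \<subseteq> F'"
  shows "components V F' = (\<lambda>C. conn V F' `` C) ` components V F"
  unfolding components_image image_image
  by (rule image_cong) (simp_all add: conn_image_class[OF assms])

lemma card_components_insert_separated:
  assumes "finite V" "x \<in> V" "y \<in> V" "(x, y) \<notin> conn V F"
  shows "card (components V (insert (x, y) F)) < card (components V F)"
proof -
  let ?F = "insert (x, y) F"
  let ?h = "\<lambda>C. conn V ?F `` C"
  have im: "components V ?F = ?h ` components V F"
    by (rule components_image_mono) auto
  have "\<not> inj_on ?h (components V F)"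
  proof
    assume inj: "inj_on ?h (components V F)"
    have "(x, y) \<in> conn V ?F"
      using assms by (intro conn_edge) auto
    then have "?h (conn V F `` {x}) = ?h (conn V F `` {y})"
      using assms conn_class_eq_iff[of x V y ?F]
      by (simp add: conn_image_class[OF subset_insertI])
    then have "conn V F `` {x} = conn V F `` {y}"
      by (rule inj_onD[OF inj]) (simp_all add: components_image assms)
    then show False
      using assms conn_class_eq_iff[of x V y F] by simp
  qed
  then have "card (?h ` components V F) \<noteq> card (components V F)"
    using eq_card_imp_inj_on finite_components[OF assms(1)] by blast
  then show ?thesis
    using im card_image_le[OF finite_components[OF assms(1)], of ?h F] by simp
qed

text \<open>A walk may use the new edge several times; an invariant with three cases avoids cutting
  it into pieces.\<close>

lemma conn_insert_cases:
  assumes "(a, b) \<in> conn V (insert (x, y) F)"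
  shows "(a, b) \<in> conn V F \<or> ((a, x) \<in> conn V F \<and> (b, y) \<in> conn V F)
    \<or> ((a, y) \<in> conn V F \<and> (b, x) \<in> conn V F)"
  using assms
proof (induction rule: conn_induct)
  case base
  then show ?case using assms conn_in conn_refl by metis
next
  case (step z w)
  show ?case
  proof (cases "(z, w) \<in> F \<or> (w, z) \<in> F")
    case True
    then have "(w, z) \<in> conn V F" "(z, w) \<in> conn V F"
      using step by (auto intro: conn_edge)
    then show ?thesis
      using step.IH conn_trans by metis
  next
    case False
    then have "z = x \<and> w = y \<or> z = y \<and> w = x"
      using step by auto
    moreover have "(z, z) \<in> conn V F" "(w, w) \<in> conn V F"
      using step by (auto intro: conn_refl)
    ultimately show ?thesis
      using step.IH conn_trans conn_sym by metis
  qed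
qed

text \<open>Only the classes of \<open>x\<close> and \<open>y\<close> can be merged, so the merging
  map is injective once the class of \<open>y\<close> is left out.\<close>

lemma card_components_insert_ge:
  assumes "finite V"
  shows "card (components V F) \<le> card (components V (insert (x, y) F)) + 1"
proof -
  let ?F = "insert (x, y) F"
  let ?h = "\<lambda>C. conn V ?F `` C"
  let ?K = "components V F - {conn V F `` {y}}"
  have fin: "finite (components V F)" "finite (components V ?F)"
    using assms by (auto intro: finite_components)
  have "inj_on ?h ?K"
  proof (rule inj_onI)
    fix C D assume CD: "C \<in> ?K" "D \<in> ?K" "?h C = ?h D"
    obtain a b where a: "a \<in> V" "C = conn V F `` {a}" and b: "b \<in> V" "D = conn V F `` {b}"
      using CD by (auto simp: components_image)
    have "conn V ?F `` {a} = conn V ?F `` {b}"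
      using CD(3) a b by (simp add: conn_image_class[OF subset_insertI])
    then have "(a, b) \<in> conn V ?F"
      using a b by (simp add: conn_class_eq_iff)
    moreover have "(a, y) \<notin> conn V F" "(b, y) \<notin> conn V F"
      using CD a b conn_class_eq_iff conn_in by (metis DiffE singletonI)+
    ultimately have "(a, b) \<in> conn V F"
      using conn_insert_cases[of a b V x y F] by blast
    then show "C = D"
      using a b by (simp add: conn_class_eq_iff)
  qed
  then have "card ?K = card (?h ` ?K)"
    by (simp add: card_image)
  also have "\<dots> \<le> card (components V ?F)"
    using fin components_image_mono[of F ?F V] by (intro card_mono) (auto simp: subset_insertI)
  finally show ?thesis
    using card_Diff_singleton_if[of "components V F" "conn V F `` {y}"] by (auto split: if_splits)
qed

lemma card_components_Un_ge:
  assumes "finite V" "finite L"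
  shows "card (components V F) \<le> card (components V (F \<union> L)) + card L"
  using assms(2)
proof induction
  case (insert e L)
  then show ?case
    using card_components_insert_ge[OF assms(1), of "F \<union> L" "fst e" "snd e"] by simp
qed simp

text \<open>If no edge is bypassed by the others, inserting them one at a time joins two separate
  components each time, as in a forest. The contrapositive yields the redundant edge for the second
  exchange.\<close>

lemma card_components_irredundant:
  assumes "finite V" "finite I"
    and "\<And>i. i \<in> I \<Longrightarrow> fst (f i) \<in> V \<and> snd (f i) \<in> V"
    and "\<And>i. i \<in> I \<Longrightarrow> f i \<notin> conn V (F \<union> f ` (I - {i}))"
  shows "card (components V (F \<union> f ` I)) + card I \<le> card (components V F)"
  using assms(2-4)
proof (induction I)
  case (insert i I)
  have "f j \<notin> conn V (F \<union> f ` (I - {j}))" if "j \<in> I" for j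
  proof
    assume "f j \<in> conn V (F \<union> f ` (I - {j}))"
    then have "f j \<in> conn V (F \<union> f ` (insert i I - {j}))"
      using conn_mono[of V V "F \<union> f ` (I - {j})" "F \<union> f ` (insert i I - {j})" "fst (f j)" "snd (f j)"]
      by auto
    then show False using insert.prems(2)[of j] that by simp
  qed
  then have IH: "card (components V (F \<union> f ` I)) + card I \<le> card (components V F)"
    using insert by blast
  have "(fst (f i), snd (f i)) \<notin> conn V (F \<union> f ` I)"
    using insert.prems(2)[of i] insert.hyps by simp
  then have "card (components V (insert (fst (f i), snd (f i)) (F \<union> f ` I))) < card (components V (F \<union> f ` I))"
    using insert.prems(1) assms(1) by (intro card_components_insert_separated) auto
  then show ?case
    using IH insert.hyps by simp
qed simp

section \<open>Blocks\<close>

lemma conn_avoid_edge: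
  assumes "(x, y) \<in> conn (V - {v}) E" "v = fst e \<or> v = snd e"
  shows "(x, y) \<in> conn V (E - {e})"
  using assms(1)
proof (rule conn_within)
  show "x \<in> V"
    using conn_in[OF assms(1)] by simp
  fix a b assume "(x, a) \<in> conn (V - {v}) E" "(x, b) \<in> conn (V - {v}) E" "(a, b) \<in> E"
  then show "a \<in> V \<and> b \<in> V \<and> (a, b) \<in> E - {e}"
    using assms(2) conn_in[of x _ "V - {v}" E] by fastforce
qed

lemma third_element:
  assumes "card S \<ge> 3"
  obtains t where "t \<in> S" "t \<noteq> x" "t \<noteq> y"
proof -
  have "\<not> S \<subseteq> {x, y}"
  proof
    assume "S \<subseteq> {x, y}"
    then have "card S \<le> card {x, y}" by (intro card_mono) auto
    also have "\<dots> \<le> 2" by (simp add: card_insert_if)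
    finally show False using assms by simp
  qed
  then show ?thesis using that by blast
qed

text \<open>For an edge \<open>xy\<close> and a third vertex \<open>t\<close>, the connection of \<open>x\<close> to \<open>t\<close> avoiding \<open>y\<close> and the one of
  \<open>y\<close> to \<open>t\<close> avoiding \<open>x\<close> bypass \<open>xy\<close>; hence edge deletions need no separate treatment.\<close>

lemma biconnected_set_if_not_separated:
  assumes "S \<subseteq> V" "card S \<ge> 3" "\<And>x. (x, x) \<notin> E"
    and sep: "\<And>v x y. v \<in> V \<Longrightarrow> x \<in> S - {v} \<Longrightarrow> y \<in> S - {v} \<Longrightarrow> (x, y) \<in> conn (V - {v}) E"
  shows "biconnected_set V E S"
  unfolding biconnected_set_def
proof (intro conjI ballI impI)
  fix x y assume xy: "x \<in> S" "y \<in> S" "x \<noteq> y"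
  obtain t where t: "t \<in> S" "t \<noteq> x" "t \<noteq> y"
    using third_element[OF assms(2)] by blast
  show "biconnected V E x y"
    unfolding biconnected_def
  proof (intro conjI ballI)
    have "(x, y) \<in> conn (V - {t}) E"
      using xy t assms(1) by (intro sep) auto
    then show "(x, y) \<in> conn V E"
      by (rule conn_mono[rotated -1]) auto
  next
    fix v assume "v \<in> V - {x, y}"
    then show "(x, y) \<in> conn (V - {v}) E"
      using xy by (intro sep) auto
  next
    fix e assume e: "e \<in> E"
    have avoid: "(a, b) \<in> conn V (E - {e})"
      if "a \<in> S" "b \<in> S" "v \<noteq> a" "v \<noteq> b" "v = fst e \<or> v = snd e" for a b v
    proof (rule conn_avoid_edge)
      show "v = fst e \<or> v = snd e" by (rule that)
      show "(a, b) \<in> conn (V - {v}) E"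
      proof (cases "v \<in> V")
        case True
        then show ?thesis using that by (intro sep) auto
      next
        \<comment> \<open>Edges of \<open>E\<close> may end outside \<open>V\<close>. Deleting such
          an end changes nothing, so the connection comes from the deletion of a third vertex
          \<open>t'\<close>.\<close>
        case False
        obtain t' where t': "t' \<in> S" "t' \<noteq> a" "t' \<noteq> b"
          using third_element[OF assms(2)] by blast
        then have "(a, b) \<in> conn (V - {t'}) E"
          using that assms(1) by (intro sep) auto
        then have "(a, b) \<in> conn V E"
          by (rule conn_mono[rotated -1]) auto
        then show ?thesis using False by simp
      qed
    qed
    show "(x, y) \<in> conn V (E - {e})"
    proof (cases "x \<noteq> fst e \<and> y \<noteq> fst e \<or> x \<noteq> snd e \<and> y \<noteq> snd e")
      case True
      then show ?thesis using avoid xy by metis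
    next
      case False
      moreover have "fst e \<noteq> snd e"
        using assms(3)[of "fst e"] e by (cases e) auto
      ultimately have "x = fst e \<and> y = snd e \<or> x = snd e \<and> y = fst e"
        by auto
      then have "(x, t) \<in> conn V (E - {e})" "(t, y) \<in> conn V (E - {e})"
        using avoid[of x t y] avoid[of t y x] xy t by auto
      then show ?thesis by (rule conn_trans)
    qed
  qed
qed (rule assms(1))

lemma block_whole_if_not_separated:
  assumes "card V \<ge> 3" "\<And>x. (x, x) \<notin> E"
    and "\<And>v x y. v \<in> V \<Longrightarrow> x \<in> V - {v} \<Longrightarrow> y \<in> V - {v} \<Longrightarrow> (x, y) \<in> conn (V - {v}) E"
  shows "block V E V"
proof -
  have "biconnected_set V E V"
    using assms by (intro biconnected_set_if_not_separated) auto
  then show ?thesis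
    using assms(1) by (auto simp: block_def biconnected_set_def)
qed

lemma block_whole_not_separated:
  assumes "block V E V" "v \<in> V" "x \<in> V - {v}" "y \<in> V - {v}"
  shows "(x, y) \<in> conn (V - {v}) E"
proof (cases "x = y")
  case True
  then show ?thesis using assms conn_refl by metis
next
  case False
  then show ?thesis
    using assms by (auto simp: block_def biconnected_set_def biconnected_def)
qed

lemma components_connected:
  assumes "connected_graph V E"
  shows "components V E = {V}"
proof -
  have "conn V E `` {x} = V" if "x \<in> V" for x
    using that assms conn_in[of x _ V E] by (auto simp: connected_graph_def)
  then show ?thesis
    using assms by (auto simp: components_image connected_graph_def)
qed

lemma connected_graph_mono:
  assumes "connected_graph V E" "E \<subseteq> F"
  shows "connected_graph V F"
  using assms conn_mono[of V V E F] by (auto simp: connected_graph_def)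

section \<open>Cut vertices of a connected bipartite graph\<close>

locale bipartite_connected =
  fixes A B :: "'a set" and E :: "('a \<times> 'a) set"
  assumes bipartite: "bipartite_graph A B E"
    and connected: "connected_graph (A \<union> B) E"
    and card_A: "card A \<ge> 2"
    and card_B: "card B \<ge> 2"
begin

abbreviation V :: "'a set" where "V \<equiv> A \<union> B"

lemma finite_V: "finite V"
  using bipartite by (simp add: bipartite_graph_def)

lemma disjoint: "A \<inter> B = {}"
  using bipartite by (simp add: bipartite_graph_def)

lemma E_subset: "E \<subseteq> A \<times> B"
  using bipartite by (simp add: bipartite_graph_def)

lemma card_V: "card V \<ge> 4"
  using card_A card_B disjoint bipartite
  by (simp add: bipartite_graph_def card_Un_disjoint)

lemma no_loop: "L \<subseteq> A \<times> B \<Longrightarrow> (x, x) \<notin> E \<union> L"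
  using E_subset disjoint by auto

lemma conn_V: "x \<in> V \<Longrightarrow> y \<in> V \<Longrightarrow> (x, y) \<in> conn V E"
  using connected by (simp add: connected_graph_def)

lemma cut_vertex_iff:
  "cut_vertex V E v \<longleftrightarrow> v \<in> V \<and> (\<exists>x\<in>V - {v}. \<exists>y\<in>V - {v}. (x, y) \<notin> conn (V - {v}) E)"
proof -
  have "card (components V E) = 1"
    by (simp add: components_connected[OF connected])
  then show ?thesis
    using card_components_le_1_iff[of "V - {v}" E] finite_V
    by (auto simp: cut_vertex_def not_less[symmetric] simp del: Un_iff)
qed

lemma conn_not_cut_vertex:
  assumes "\<not> cut_vertex V E v" "x \<in> V - {v}" "y \<in> V - {v}"
  shows "(x, y) \<in> conn (V - {v}) E"
proof (cases "v \<in> V")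
  case False
  then have "V - {v} = V" by blast
  then show ?thesis using conn_V assms by auto
next
  case True
  then show ?thesis using assms cut_vertex_iff[of v] by blast
qed

lemma conn_to_deleted:
  assumes "x \<in> V" "u \<in> V" "x \<noteq> u" "v \<noteq> u" "(x, v) \<notin> conn (V - {u}) E"
  shows "(x, u) \<in> conn (V - {v}) E"
  using conn_via_deleted[OF conn_V[OF assms(1,2)] assms(3-5)] .

section \<open>Pendant blocks inside the components left by a cut vertex\<close>

text \<open>\<open>c\<close> is a leaf attached to \<open>u\<close>. Its only edge is a bridge, so
  no second vertex is biconnected with \<open>c\<close>.\<close>

lemma pendant_block_singleton:
  assumes u: "u \<in> V" and c: "c \<in> V - {u}" and C: "conn (V - {u}) E `` {c} = {c}"
  shows "pendant_block V E {c}"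
proof -
  have nb: "t = u" if "(c, t) \<in> E \<or> (t, c) \<in> E" for t
  proof (rule ccontr)
    assume "t \<noteq> u"
    then have "(c, t) \<in> conn (V - {u}) E"
      using that c E_subset by (intro conn_edge) auto
    then have "t = c" using C by blast
    then show False using that E_subset disjoint by auto
  qed
  have cu: "(c, u) \<in> E \<or> (u, c) \<in> E"
  proof (rule ccontr)
    assume *: "\<not> ?thesis"
    have "u \<in> {c}"
      by (rule conn_closed[OF conn_V[of c u]]) (use c u nb * in auto)
    then show False using c by simp
  qed
  have "{w. (c, w) \<in> adj V E} = {u}"
  proof
    show "{w. (c, w) \<in> adj V E} \<subseteq> {u}"
      using nb by (auto simp: adj_def)
    show "{u} \<subseteq> {w. (c, w) \<in> adj V E}"
      using cu c u by (simp add: adj_def)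
  qed
  then have deg: "degree V E c = 1"
    by (simp add: degree_def)
  \<comment> \<open>\<open>E\<close> lists each edge once, so the deleted edge must be taken in the
    orientation that occurs; bipartiteness excludes the other one.\<close>
  define e where "e = (if (c, u) \<in> E then (c, u) else (u, c))"
  have e: "e \<in> E" "e = (c, u) \<or> e = (u, c)"
    using cu by (auto simp: e_def)
  have "\<not> ((c, u) \<in> E \<and> (u, c) \<in> E)"
    using E_subset disjoint by blast
  then have "(c, u) \<notin> E - {e}" "(u, c) \<notin> E - {e}"
    by (auto simp: e_def)
  then have only: "(c, t) \<notin> E - {e} \<and> (t, c) \<notin> E - {e}" for t
    using nb[of t] by blast
  have "block V E {c}"
    unfolding block_def
  proof (intro conjI allI impI)
    show "biconnected_set V E {c}"
      using c by (simp add: biconnected_set_def)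
    fix T assume T: "biconnected_set V E T \<and> {c} \<subseteq> T"
    have "t = c" if "t \<in> T" for t
    proof (rule ccontr)
      assume "t \<noteq> c"
      then have "(c, t) \<in> conn V (E - {e})"
        using T that e(1) by (auto simp: biconnected_set_def biconnected_def)
      then have "t \<in> {c}"
        by (rule conn_closed) (use only in auto)
      then show False using \<open>t \<noteq> c\<close> by simp
    qed
    then show "T = {c}" using T by blast
  qed simp
  then show ?thesis
    using deg by (auto simp: pendant_block_def)
qed

text \<open>Biconnected: deleting a vertex of \<open>C\<close> leaves the whole graph connected,
  deleting \<open>u\<close> leaves the component \<open>C\<close>, and deleting any other vertex
  leaves each vertex of \<open>C\<close> joined to \<open>u\<close>. Maximal: \<open>u\<close>
  separates \<open>C\<close> from everything else.\<close>

lemma pendant_block_insert_cut: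
  assumes u: "u \<in> V" and c: "c \<in> V - {u}" and d: "d \<in> V - {u}"
    and cd: "(c, d) \<notin> conn (V - {u}) E"
    and C: "C = conn (V - {u}) E `` {c}" and "C \<noteq> {c}"
    and nocut: "\<And>v. v \<in> C \<Longrightarrow> \<not> cut_vertex V E v"
  shows "pendant_block V E (insert u C)"
proof -
  have CV: "C \<subseteq> V - {u}"
    unfolding C using conn_in[of c _ "V - {u}" E] by blast
  have cC: "c \<in> C"
    unfolding C using conn_refl[OF c] by blast
  then obtain c' where c': "c' \<in> C" "c' \<noteq> c"
    using \<open>C \<noteq> {c}\<close> by blast
  have fin: "finite (insert u C)"
    using finite_V CV finite_subset[of C V] by blast
  have "card {u, c, c'} \<le> card (insert u C)"
    by (rule card_mono[OF fin]) (use cC c' in auto)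
  moreover have "u \<noteq> c" "u \<noteq> c'"
    using cC c' CV by blast+
  then have "card {u, c, c'} = 3"
    using c' by simp
  ultimately have card3: "card (insert u C) \<ge> 3" by simp
  have inC: "(x, y) \<in> conn (V - {u}) E" if "x \<in> C" "y \<in> C" for x y
    using that conn_sym[of c x "V - {u}" E] conn_trans[of x c "V - {u}" E y] unfolding C by blast
  have bic: "biconnected_set V E (insert u C)"
  proof (rule biconnected_set_if_not_separated)
    show "insert u C \<subseteq> V" using CV u by blast
    show "card (insert u C) \<ge> 3" by (rule card3)
    show "(x, x) \<notin> E" for x using no_loop[of "{}"] by simp
    fix v x y assume v: "v \<in> V" and xy: "x \<in> insert u C - {v}" "y \<in> insert u C - {v}"
    consider "v \<in> C" | "v = u" | "v \<notin> insert u C" by blast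
    then show "(x, y) \<in> conn (V - {v}) E"
    proof cases
      case 1
      then show ?thesis
        using xy CV u by (intro conn_not_cut_vertex nocut) auto
    next
      case 2
      then show ?thesis using xy inC by blast
    next
      case 3
      have *: "(x, u) \<in> conn (V - {v}) E" if "x \<in> insert u C" for x
      proof (cases "x = u")
        case True
        then show ?thesis using u 3 conn_refl[of u "V - {v}" E] by blast
      next
        case False
        then have x: "x \<in> C" using that by blast
        then have "(x, v) \<notin> conn (V - {u}) E"
          using 3 conn_trans[of c x "V - {u}" E v] unfolding C by blast
        then show ?thesis
          using x CV u 3 by (intro conn_to_deleted) auto
      qed
      show ?thesis
        using conn_trans[OF *[of x] conn_sym[OF *[of y]]] xy by blast
    qed
  qed
  have blk: "block V E (insert u C)"
    unfolding block_def
  proof (intro conjI allI impI)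
    fix T assume T: "biconnected_set V E T \<and> insert u C \<subseteq> T"
    have "t \<in> insert u C" if t: "t \<in> T" for t
    proof (rule ccontr)
      assume nt: "t \<notin> insert u C"
      then have "biconnected V E c t" "u \<in> V - {c, t}"
        using T t cC CV u by (auto simp: biconnected_set_def)
      then have "(c, t) \<in> conn (V - {u}) E"
        by (auto simp: biconnected_def)
      then show False using nt C by blast
    qed
    then show "T = insert u C" using T by blast
  qed (use bic in auto)
  have "cut_vertex V E u"
    using u c d cd cut_vertex_iff[of u] by blast
  then have "\<exists>!v. v \<in> insert u C \<and> cut_vertex V E v"
    using nocut by blast
  then show ?thesis
    using blk card3 by (simp add: pendant_block_def)
qed

text \<open>Descent on the size of the component. A cut vertex \<open>v\<close> in it cuts off a
  smaller component that avoids \<open>u\<close>; without a cut vertex the component itself, joined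
  by \<open>u\<close> if it has more than one vertex, is the pendant block. The claim about
  \<open>non_cut\<close> later forces an edge of the family to end in this component.\<close>

lemma pendant_block_in_component:
  assumes "u \<in> V" "c \<in> V - {u}" "d \<in> V - {u}" "(c, d) \<notin> conn (V - {u}) E"
  obtains S where "pendant_block V E S" "non_cut A B E S \<noteq> {}"
    "non_cut A B E S \<subseteq> conn (V - {u}) E `` {c}"
proof -
  have "\<exists>S. pendant_block V E S \<and> non_cut A B E S \<noteq> {} \<and>
      non_cut A B E S \<subseteq> conn (V - {u}) E `` {c}"
    using assms
  proof (induction "card (conn (V - {u}) E `` {c})" arbitrary: u c d rule: less_induct)
    case less
    note u = less.prems(1) and c = less.prems(2) and d = less.prems(3) and cd = less.prems(4)
    define C where "C = conn (V - {u}) E `` {c}"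
    have CV: "C \<subseteq> V - {u}"
      unfolding C_def using conn_in[of c _ "V - {u}" E] by blast
    have cC: "c \<in> C"
      unfolding C_def using conn_refl[OF c] by blast
    show ?case
    proof (cases "\<exists>v\<in>C. cut_vertex V E v")
      case True
      then obtain v where v: "v \<in> C" "cut_vertex V E v" by blast
      then have vV: "v \<in> V" "v \<noteq> u" using CV by auto
      obtain p q where p: "p \<in> V - {v}" and q: "q \<in> V - {v}"
        and pq: "(p, q) \<notin> conn (V - {v}) E"
        using v(2) cut_vertex_iff[of v] by blast
      then have "(p, u) \<notin> conn (V - {v}) E \<or> (q, u) \<notin> conn (V - {v}) E"
        using conn_trans[of p u "V - {v}" E q] conn_sym[of q u "V - {v}" E] by blast
      \<comment> \<open>The two vertices separated by \<open>v\<close> cannot both stay joined to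
        \<open>u\<close>; from here on \<open>p\<close> is one that is cut off from
        \<open>u\<close>.\<close>
      then obtain p where p: "p \<in> V - {v}" and pu: "(p, u) \<notin> conn (V - {v}) E"
        using p q by blast
      let ?D = "conn (V - {v}) E `` {p}"
      have "?D \<subseteq> C"
      proof
        fix z assume "z \<in> ?D"
        then have z: "(p, z) \<in> conn (V - {v}) E" by simp
        then have "(z, u) \<notin> conn (V - {v}) E"
          using pu conn_trans[of p z "V - {v}" E u] by blast
        \<comment> \<open>\<open>conn_to_deleted\<close> with the roles of \<open>u\<close> and
          \<open>v\<close> exchanged: cut off from \<open>u\<close> by \<open>v\<close>, the vertex
          \<open>z\<close> reaches \<open>v\<close> without \<open>u\<close>.\<close>
        then have "(z, v) \<in> conn (V - {u}) E"
          using conn_in[OF z] vV u by (intro conn_to_deleted) auto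
        then show "z \<in> C"
          using v(1) conn_sym[of z v "V - {u}" E] conn_trans[of c v "V - {u}" E z]
          unfolding C_def by blast
      qed
      moreover have "v \<notin> ?D"
        using conn_in[of p v "V - {v}" E] by blast
      ultimately have "?D \<subset> C" using v(1) by blast
      moreover have "finite C"
        using CV finite_V finite_subset[of C V] by blast
      ultimately have "card ?D < card C"
        by (simp add: psubset_card_mono)
      then obtain S where "pendant_block V E S" "non_cut A B E S \<noteq> {}" "non_cut A B E S \<subseteq> ?D"
        using less.hyps[of v p u] vV u p pu unfolding C_def by blast
      then show ?thesis using \<open>?D \<subset> C\<close> unfolding C_def by blast
    next
      case False
      then have nocut: "\<And>v. v \<in> C \<Longrightarrow> \<not> cut_vertex V E v" by blast
      show ?thesis
      proof (cases "C = {c}")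
        case True
        then have "pendant_block V E {c}"
          using u c unfolding C_def by (intro pendant_block_singleton)
        moreover have "non_cut A B E {c} = {c}"
          using nocut[OF cC] by (auto simp: non_cut_def)
        ultimately show ?thesis
          using cC unfolding C_def by (intro exI[of _ "{c}"]) auto
      next
        case False
        have "pendant_block V E (insert u C)"
          by (rule pendant_block_insert_cut[OF u c d cd C_def False nocut])
        moreover have "cut_vertex V E u"
          using u c d cd cut_vertex_iff[of u] by blast
        then have "non_cut A B E (insert u C) = C"
          using nocut by (auto simp: non_cut_def)
        ultimately show ?thesis
          using cC unfolding C_def by (intro exI[of _ "insert u (conn (V - {u}) E `` {c})"]) auto
      qed
    qed
  qed
  then show ?thesis using that by blast
qed

subsection \<open>The lower bound\<close>

lemma componentwise_biconnected_iff:
  "componentwise_biconnected V (E \<union> L) \<longleftrightarrow> block V (E \<union> L) V"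
  using components_connected[OF connected_graph_mono[OF connected, of "E \<union> L"]]
  by (simp add: componentwise_biconnected_def)

text \<open>Includes \<open>x = y\<close>, on which \<open>biconnected_set\<close> is silent, so
  that connections can be chained through a common vertex without case distinctions.\<close>

lemma biconnected_setD:
  assumes "biconnected_set V E S" "x \<in> S" "y \<in> S"
  shows "(x, y) \<in> conn V E"
    and "e \<in> E \<Longrightarrow> (x, y) \<in> conn V (E - {e})"
    and "v \<in> V \<Longrightarrow> v \<noteq> x \<Longrightarrow> v \<noteq> y \<Longrightarrow> (x, y) \<in> conn (V - {v}) E"
proof -
  have xV: "x \<in> V" using assms by (auto simp: biconnected_set_def)
  have *: "x = y \<or> biconnected V E x y"
    using assms by (auto simp: biconnected_set_def)
  show "(x, y) \<in> conn V E"
    using * xV conn_refl[of x V E] by (auto simp: biconnected_def)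
  show "(x, y) \<in> conn V (E - {e})" if "e \<in> E"
    using * xV that conn_refl[of x V "E - {e}"] by (auto simp: biconnected_def)
  show "(x, y) \<in> conn (V - {v}) E" if "v \<in> V" "v \<noteq> x" "v \<noteq> y"
    using * xV that conn_refl[of x "V - {v}" E] by (auto simp: biconnected_def)
qed

lemma biconnected_sym:
  assumes "biconnected V E x y"
  shows "biconnected V E y x"
  unfolding biconnected_def
  by (intro conjI ballI; rule conn_sym) (use assms in \<open>auto simp: biconnected_def\<close>)

lemma block_maximal: "block V E S \<Longrightarrow> biconnected_set V E T \<Longrightarrow> S \<subseteq> T \<Longrightarrow> T = S"
  by (simp add: block_def)

text \<open>Connections inside \<open>S\<close> and inside \<open>T\<close> are chained at
  \<open>p\<close>. Only the deletion of \<open>p\<close> breaks the chain, which is harmless as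
  \<open>p\<close> is no cut vertex. Thus \<open>S \<union> T\<close> is biconnected, and both
  blocks equal it by maximality.\<close>

lemma blocks_equal_if_common_non_cut_vertex:
  assumes "block V E S" "block V E T" "p \<in> S" "p \<in> T" "\<not> cut_vertex V E p"
  shows "S = T"
proof -
  have S: "biconnected_set V E S" and T: "biconnected_set V E T"
    using assms by (auto simp: block_def)
  have bic: "biconnected V E s t" if "s \<in> S" "t \<in> T" for s t
    unfolding biconnected_def
  proof (intro conjI ballI)
    show "(s, t) \<in> conn V E"
      using biconnected_setD(1)[OF S that(1) assms(3)] biconnected_setD(1)[OF T assms(4) that(2)]
      by (rule conn_trans)
    show "(s, t) \<in> conn V (E - {e})" if "e \<in> E" for e
      using biconnected_setD(2)[OF S \<open>s \<in> S\<close> assms(3) that]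
        biconnected_setD(2)[OF T assms(4) \<open>t \<in> T\<close> that]
      by (rule conn_trans)
    fix v assume v: "v \<in> V - {s, t}"
    show "(s, t) \<in> conn (V - {v}) E"
    proof (cases "v = p")
      case True
      have "s \<in> V" "t \<in> V"
        using S T that by (auto simp: biconnected_set_def)
      then show ?thesis
        using v assms(5) True by (intro conn_not_cut_vertex) auto
    next
      case False
      then show ?thesis
        using biconnected_setD(3)[OF S that(1) assms(3)] biconnected_setD(3)[OF T assms(4) that(2)] v
          conn_trans[of s p "V - {v}" E t] by blast
    qed
  qed
  have "biconnected_set V E (S \<union> T)"
    unfolding biconnected_set_def
  proof (intro conjI ballI impI)
    show "S \<union> T \<subseteq> V" using S T by (simp add: biconnected_set_def)
    fix x y assume "x \<in> S \<union> T" "y \<in> S \<union> T" "x \<noteq> y"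
    then show "biconnected V E x y"
      using bic[of x y] biconnected_sym[OF bic[of y x]] S T
      by (auto simp: biconnected_set_def)
  qed
  then show ?thesis
    using block_maximal[OF assms(1)] block_maximal[OF assms(2)] by blast
qed

text \<open>Otherwise \<open>insert q S\<close> would be a larger biconnected set: \<open>q\<close>
  reaches \<open>S\<close> through \<open>p\<close>, and also without \<open>p\<close> because
  \<open>p\<close> is no cut vertex. The second vertex \<open>s\<close> excludes a leaf, whose
  neighbour lies outside its block.\<close>

lemma block_closed_at_non_cut_vertex:
  assumes "block V E S" "p \<in> S" "s \<in> S" "s \<noteq> p" "\<not> cut_vertex V E p"
    and "q \<in> V" and pq: "(p, q) \<in> E \<or> (q, p) \<in> E"
  shows "q \<in> S"
proof (rule ccontr)
  assume "q \<notin> S"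
  have S: "biconnected_set V E S" and SV: "S \<subseteq> V"
    using assms by (auto simp: block_def biconnected_set_def)
  have bic: "biconnected V E q t" if "t \<in> S" for t
    unfolding biconnected_def
  proof (intro conjI ballI)
    have "(q, p) \<in> conn V E"
      using assms SV by (intro conn_edge) auto
    then show "(q, t) \<in> conn V E"
      using biconnected_setD(1)[OF S assms(2) that] by (rule conn_trans)
    fix v assume v: "v \<in> V - {q, t}"
    show "(q, t) \<in> conn (V - {v}) E"
    proof (cases "v = p")
      case True
      then show ?thesis
        using v assms that SV by (intro conn_not_cut_vertex) auto
    next
      case False
      have "(q, p) \<in> conn (V - {v}) E"
        using assms SV v False by (intro conn_edge) auto
      then show ?thesis
        using biconnected_setD(3)[OF S assms(2) that, of v] v False conn_trans[of q p "V - {v}" E t]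
        by blast
    qed
  next
    fix e assume e: "e \<in> E"
    show "(q, t) \<in> conn V (E - {e})"
    proof (cases "e = (p, q) \<or> e = (q, p)")
      case True
      \<comment> \<open>With the edge between \<open>p\<close> and \<open>q\<close> deleted, a route
        to \<open>s\<close> that avoids \<open>p\<close> altogether replaces it.\<close>
      have "(q, s) \<in> conn (V - {p}) E"
        using assms SV \<open>q \<notin> S\<close> by (intro conn_not_cut_vertex) auto
      then have "(q, s) \<in> conn V (E - {e})"
        using True by (intro conn_avoid_edge) auto
      then show ?thesis
        using biconnected_setD(2)[OF S assms(3) that e] by (rule conn_trans)
    next
      case False
      then have "(q, p) \<in> conn V (E - {e})"
        using assms SV by (intro conn_edge) auto
      then show ?thesis
        using biconnected_setD(2)[OF S assms(2) that e] by (rule conn_trans)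
    qed
  qed
  have "biconnected_set V E (insert q S)"
    using S bic biconnected_sym[OF bic] assms(6) by (auto simp: biconnected_set_def)
  then show False
    using block_maximal[OF assms(1)] \<open>q \<notin> S\<close> by blast
qed

text \<open>Without such an edge, the neighbour of a leaf, or the unique cut vertex of a nonsingular
  block, would still separate the pendant block from the rest.\<close>

lemma biconnector_hits_pendant_block:
  assumes S: "pendant_block V E S" and L: "L \<subseteq> A \<times> B" and blk: "block V (E \<union> L) V"
  shows "\<exists>e p. e \<in> L \<and> (p = fst e \<or> p = snd e) \<and> p \<in> S \<and> (S = {p} \<or> \<not> cut_vertex V E p)"
proof (cases "card S = 1")
  case True
  then obtain v where v: "S = {v}" and deg: "degree V E v = 1"
    using S by (auto simp: pendant_block_def)
  have vV: "v \<in> V"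
    using S v by (auto simp: pendant_block_def block_def biconnected_set_def)
  obtain n where n: "{w. (v, w) \<in> adj V E} = {n}"
    using deg card_1_singletonE unfolding degree_def by blast
  have nV: "n \<in> V" "n \<noteq> v"
    using n no_loop[of "{}"] by (auto simp: adj_def)
  obtain t where t: "t \<in> V" "t \<noteq> v" "t \<noteq> n"
    using third_element[of V v n] card_V by auto
  have "\<exists>e\<in>L. v = fst e \<or> v = snd e"
  proof (rule ccontr)
    assume no: "\<not> ?thesis"
    have "(v, t) \<in> conn (V - {n}) (E \<union> L)"
      using vV nV t by (intro block_whole_not_separated[OF blk]) auto
    then have "t \<in> {v}"
    proof (rule conn_closed)
      fix a b assume ab: "a \<in> {v}" "b \<in> V - {n}" "(a, b) \<in> E \<union> L \<or> (b, a) \<in> E \<union> L"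
      then have "(v, b) \<in> E \<or> (b, v) \<in> E"
        using no by force
      then have "(v, b) \<in> adj V E"
        using ab vV by (simp add: adj_def)
      then show "b \<in> {v}" using n ab by blast
    qed simp
    then show False using t by simp
  qed
  then show ?thesis using v by blast
next
  case False
  then have blkS: "block V E S" and "\<exists>!v. v \<in> S \<and> cut_vertex V E v"
    using S by (auto simp: pendant_block_def)
  then obtain c where c: "c \<in> S" "cut_vertex V E c"
    and only: "\<And>v. v \<in> S \<Longrightarrow> v \<noteq> c \<Longrightarrow> \<not> cut_vertex V E v" by blast
  have bS: "biconnected_set V E S" and SV: "S \<subseteq> V"
    using blkS by (auto simp: block_def biconnected_set_def)
  obtain p where p: "p \<in> S" "p \<noteq> c"
  proof -
    have "S \<noteq> {c}" using False by auto
    then show ?thesis using c(1) that by blast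
  qed
  obtain x y where xy: "x \<in> V - {c}" "y \<in> V - {c}" "(x, y) \<notin> conn (V - {c}) E"
    using c(2) cut_vertex_iff[of c] by blast
  \<comment> \<open>\<open>c\<close> does not separate vertices of its block from each other, so one
    of \<open>x\<close> and \<open>y\<close> lies outside \<open>S\<close>; it becomes the target
    \<open>t\<close>.\<close>
  have "\<not> (x \<in> S \<and> y \<in> S)"
    using biconnected_setD(3)[OF bS, of x y c] xy c SV by blast
  then obtain t where t: "t \<in> V - {c}" "t \<notin> S"
    using xy by blast
  have "\<exists>e\<in>L. \<exists>p\<in>S - {c}. p = fst e \<or> p = snd e"
  proof (rule ccontr)
    assume no: "\<not> ?thesis"
    have "(p, t) \<in> conn (V - {c}) (E \<union> L)"
      using p t c SV by (intro block_whole_not_separated[OF blk]) auto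
    then have "t \<in> S - {c}"
    proof (rule conn_closed)
      show "p \<in> S - {c}" using p by simp
      fix a b assume ab: "a \<in> S - {c}" "b \<in> V - {c}" "(a, b) \<in> E \<union> L \<or> (b, a) \<in> E \<union> L"
      then have "(a, b) \<in> E \<or> (b, a) \<in> E"
        using no by force
      then have "b \<in> S"
        using block_closed_at_non_cut_vertex[OF blkS, of a c b] ab c only by blast
      then show "b \<in> S - {c}" using ab by blast
    qed
    then show False using t by simp
  qed
  then show ?thesis using only by blast
qed

section \<open>Legal matchings and the number of pendant blocks\<close>

lemma pendant_blocks_eq: "pendant_blocks A B E = {S. pendant_block V E S}"
  by (simp add: pendant_blocks_def)

lemma pendant_block_subset: "pendant_block V E S \<Longrightarrow> S \<subseteq> V"
  by (auto simp: pendant_block_def block_def biconnected_set_def)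

lemma finite_pendant_blocks: "finite (pendant_blocks A B E)"
proof (rule finite_subset)
  show "pendant_blocks A B E \<subseteq> Pow V"
    unfolding pendant_blocks_eq using pendant_block_subset by blast
  show "finite (Pow V)"
    using finite_V by blast
qed

lemma finite_legal_pairs: "finite (legal_pairs A B E)"
  by (rule finite_subset[of _ "Pow (pendant_blocks A B E)"])
    (auto simp: legal_pairs_def finite_pendant_blocks)

lemma finite_matching_sizes: "finite {card M |M. legal_matching A B E \<Lambda> M}"
proof (rule finite_subset)
  show "{card M |M. legal_matching A B E \<Lambda> M} \<subseteq> card ` Pow (legal_pairs A B E)"
    by (auto simp: legal_matching_def)
qed (simp add: finite_legal_pairs)

lemma card_le_matching_number:
  "legal_matching A B E \<Lambda> M \<Longrightarrow> card M \<le> matching_number A B E \<Lambda>"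
  unfolding matching_number_def using finite_matching_sizes by (intro Max_ge) auto

lemma maximum_matching_exists:
  obtains M where "legal_matching A B E \<Lambda> M" "card M = matching_number A B E \<Lambda>"
proof -
  have "legal_matching A B E \<Lambda> {}"
    by (simp add: legal_matching_def)
  then have "matching_number A B E \<Lambda> \<in> {card M |M. legal_matching A B E \<Lambda> M}"
    unfolding matching_number_def using finite_matching_sizes by (intro Max_in) auto
  then show ?thesis using that by auto
qed

text \<open>Legality amounts to one block admitting an end in \<open>A\<close> and the other an end
  in \<open>B\<close>. The case distinction restores the order in which \<open>legal_pairs\<close>
  lists the types.\<close>

lemma legal_pairI:
  assumes "S \<in> pendant_blocks A B E" "T \<in> pendant_blocks A B E" "S \<noteq> T"
    and "type_A A B E S \<or> type_AB A B E S" "type_B A B E T \<or> type_AB A B E T"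
  shows "{S, T} \<in> legal_pairs A B E"
proof (cases "type_A A B E S \<or> type_AB A B E T")
  case True
  then show ?thesis using assms unfolding legal_pairs_def by blast
next
  case False
  then have "{T, S} \<in> legal_pairs A B E"
    using assms unfolding legal_pairs_def by blast
  then show ?thesis by (simp add: insert_commute)
qed

lemma type_if_non_cut_vertex:
  assumes "pendant_block V E S" "p \<in> S" "S = {p} \<or> \<not> cut_vertex V E p"
  shows "p \<in> A \<Longrightarrow> type_A A B E S \<or> type_AB A B E S"
    and "p \<in> B \<Longrightarrow> type_B A B E S \<or> type_AB A B E S"
  using assms pendant_block_subset[OF assms(1)]
  by (auto simp: type_A_def type_B_def type_AB_def non_cut_def)

text \<open>An edge of \<open>L\<close> serves at most one pendant block at each of its two ends. The blocks served at a
  second end form, together with their partners at the first end, a legal matching.\<close>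

lemma card_pendant_blocks_le:
  assumes L: "L \<subseteq> A \<times> B" and blk: "block V (E \<union> L) V"
  shows "card (pendant_blocks A B E)
    \<le> card L + matching_number A B E (pendant_blocks A B E)"
proof -
  let ?\<Lambda> = "pendant_blocks A B E"
  have finL: "finite L"
    using L bipartite finite_subset[of L "A \<times> B"] by (auto simp: bipartite_graph_def)
  have "\<forall>S\<in>?\<Lambda>. \<exists>ep. fst ep \<in> L \<and> (snd ep = fst (fst ep) \<or> snd ep = snd (fst ep)) \<and> snd ep \<in> S \<and>
      (S = {snd ep} \<or> \<not> cut_vertex V E (snd ep))"
    using biconnector_hits_pendant_block[OF _ L blk] unfolding pendant_blocks_eq by simp
  then obtain gh where gh: "\<forall>S\<in>?\<Lambda>. fst (gh S) \<in> L \<and>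
      (snd (gh S) = fst (fst (gh S)) \<or> snd (gh S) = snd (fst (gh S))) \<and> snd (gh S) \<in> S \<and>
      (S = {snd (gh S)} \<or> \<not> cut_vertex V E (snd (gh S)))"
    by (rule bchoice[THEN exE])
  \<comment> \<open>\<open>g S\<close> is an edge of \<open>L\<close> that serves \<open>S\<close>,
    and \<open>h S\<close> is the end of it that is private to \<open>S\<close>.\<close>
  define g h where "g = fst \<circ> gh" and "h = snd \<circ> gh"
  have g: "g S \<in> L" and h: "h S = fst (g S) \<or> h S = snd (g S)" "h S \<in> S"
    "S = {h S} \<or> \<not> cut_vertex V E (h S)" if "S \<in> ?\<Lambda>" for S
    using gh that by (auto simp: g_def h_def)
  have eqI: "S = T" if "S \<in> ?\<Lambda>" "T \<in> ?\<Lambda>" "h S = h T" for S T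
  proof -
    have "block V E S" "block V E T"
      using that by (auto simp: pendant_blocks_eq pendant_block_def)
    moreover have "h S \<in> S" "h S \<in> T"
      using h(2) that by metis+
    ultimately show ?thesis
      using h(3)[OF that(1)] h(3)[OF that(2)] that(3) blocks_equal_if_common_non_cut_vertex
        block_maximal[of S T] block_maximal[of T S]
      by (metis block_def empty_subsetI insert_subset)
  qed
  \<comment> \<open>The blocks served at the end in \<open>B\<close> of an edge whose end in
    \<open>A\<close> serves another block. Outside \<open>D\<close>, blocks sharing an edge also
    share the end, so \<open>g\<close> is injective there.\<close>
  define D where "D = {S \<in> ?\<Lambda>. h S \<noteq> fst (g S) \<and> (\<exists>T\<in>?\<Lambda>. g T = g S \<and> h T = fst (g S))}"
  have DL: "D \<subseteq> ?\<Lambda>" by (auto simp: D_def)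
  have "inj_on g (?\<Lambda> - D)"
  proof (rule inj_onI)
    fix S T assume ST: "S \<in> ?\<Lambda> - D" "T \<in> ?\<Lambda> - D" "g S = g T"
    then have "h S = h T"
      using h(1)[of S] h(1)[of T] by (auto simp: D_def)
    then show "S = T" using ST eqI by blast
  qed
  then have "card (?\<Lambda> - D) \<le> card L"
    using g finL by (intro card_inj_on_le) auto
  moreover have "card D \<le> matching_number A B E ?\<Lambda>"
  proof -
    have "\<forall>S\<in>D. \<exists>T. T \<in> ?\<Lambda> \<and> g T = g S \<and> h T = fst (g S)"
      by (auto simp: D_def)
    then obtain \<tau> where \<tau>: "\<forall>S\<in>D. \<tau> S \<in> ?\<Lambda> \<and> g (\<tau> S) = g S \<and> h (\<tau> S) = fst (g S)"
      by (rule bchoice[THEN exE])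
    have hD: "h S = snd (g S)" "h S \<noteq> fst (g S)" if "S \<in> D" for S
      using that h(1)[of S] by (auto simp: D_def)
    let ?m = "\<lambda>S. {S, \<tau> S}"
    \<comment> \<open>Both blocks of a pair are served by the same edge, so a shared block
      identifies the two edges and hence the blocks at their ends in \<open>B\<close>.\<close>
    have same: "S = S'" if "S \<in> D" "S' \<in> D" "X \<in> ?m S" "X \<in> ?m S'" for S S' X
    proof -
      have "g S = g X" "g S' = g X"
        using that \<tau> by auto
      then have "h S = h S'"
        using hD that by simp
      then show ?thesis using that DL eqI by blast
    qed
    have "legal_matching A B E ?\<Lambda> (?m ` D)"
      unfolding legal_matching_def
    proof (intro conjI ballI impI)
      show "?m ` D \<subseteq> legal_pairs A B E"
      proof
        fix q assume "q \<in> ?m ` D"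
        then obtain S where S: "S \<in> D" "q = {S, \<tau> S}" by blast
        have S\<Lambda>: "S \<in> ?\<Lambda>" "\<tau> S \<in> ?\<Lambda>" using S DL \<tau> by auto
        have "h (\<tau> S) \<in> A" "h S \<in> B"
          using g[OF S\<Lambda>(1)] L \<tau> S hD(1)[OF S(1)] by auto
        then have "{\<tau> S, S} \<in> legal_pairs A B E"
          using S\<Lambda> \<tau> S hD[OF S(1)] h(2,3)[OF S\<Lambda>(1)] h(2,3)[OF S\<Lambda>(2)]
            type_if_non_cut_vertex(1)[of "\<tau> S" "h (\<tau> S)"] type_if_non_cut_vertex(2)[of S "h S"]
          by (intro legal_pairI) (auto simp: pendant_blocks_eq)
        then show "q \<in> legal_pairs A B E"
          using S by (simp add: insert_commute)
      qed
      show "q \<subseteq> ?\<Lambda>" if "q \<in> ?m ` D" for q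
        using that \<tau> DL by auto
      show "q = q'" if qq: "q \<in> ?m ` D" "q' \<in> ?m ` D" "X \<in> q \<and> X \<in> q'" for X q q'
      proof -
        obtain S S' where "S \<in> D" "S' \<in> D" "q = ?m S" "q' = ?m S'"
          using qq by blast
        then show ?thesis using same[of S S' X] qq(3) by blast
      qed
    qed
    then have "card (?m ` D) \<le> matching_number A B E ?\<Lambda>"
      by (rule card_le_matching_number)
    moreover have "inj_on ?m D"
      by (rule inj_onI) (rule same, auto)
    ultimately show ?thesis by (simp add: card_image)
  qed
  moreover have "card ?\<Lambda> = card (?\<Lambda> - D) + card D"
    using DL finite_pendant_blocks card_mono[OF finite_pendant_blocks DL]
    by (simp add: card_Diff_subset finite_subset)
  ultimately show ?thesis by simp
qed

lemma vertex_split_eq: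
  "u \<in> V \<Longrightarrow> vertex_split V E u = card (components (V - {u}) E)"
proof -
  assume "u \<in> V"
  then have "conn V E `` {u} = V"
    using conn_V conn_in[of u _ V E] by auto
  then show ?thesis by (simp add: vertex_split_def)
qed

text \<open>Each edge of \<open>L\<close> lowers the number of components of \<open>V - {u}\<close>
  by at most one, and at most one component may remain.\<close>

lemma vertex_split_le:
  assumes "L \<subseteq> A \<times> B" "block V (E \<union> L) V" "u \<in> V"
  shows "vertex_split V E u \<le> card L + 1"
proof -
  have "finite L"
    using assms(1) bipartite finite_subset[of L "A \<times> B"] by (auto simp: bipartite_graph_def)
  then have "card (components (V - {u}) E) \<le> card (components (V - {u}) (E \<union> L)) + card L"
    using finite_V by (intro card_components_Un_ge) auto
  moreover have "card (components (V - {u}) (E \<union> L)) \<le> 1"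
    using block_whole_not_separated[OF assms(2,3)] finite_V
    by (subst card_components_le_1_iff) auto
  ultimately show ?thesis
    using vertex_split_eq[OF assms(3)] by simp
qed

subsection \<open>The upper bound\<close>

text \<open>\<open>F'\<close> arises from \<open>F\<close> by turning an edge \<open>xu\<close> into
  \<open>xw\<close>. If \<open>v\<close> lies outside the component of \<open>x\<close> in
  \<open>V - {u}\<close>, then \<open>x\<close> reaches \<open>u\<close> within \<open>E\<close>;
  otherwise the component of \<open>w\<close> misses \<open>v\<close>, and the detour runs from
  \<open>x\<close> over \<open>w\<close> to \<open>u\<close>.\<close>

lemma conn_move_end:
  assumes u: "u \<in> V" and x: "x \<in> V - {u}" and w: "w \<in> V - {u}"
    and EF: "E \<subseteq> F" "E \<subseteq> F'" and xw: "(x, w) \<notin> conn (V - {u}) F"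
    and FF': "F \<subseteq> F' \<union> {(x, u), (u, x)}" and xwF': "(x, w) \<in> F' \<or> (w, x) \<in> F'"
    and ab: "(a, b) \<in> conn (V - {v}) F"
  shows "(a, b) \<in> conn (V - {v}) F'"
  using ab
proof (rule conn_subset)
  fix p q assume pq: "p \<in> V - {v}" "q \<in> V - {v}" "(p, q) \<in> F"
  have liftF: "(s, t) \<in> conn (V - {u}) F" if "(s, t) \<in> conn (V - {u}) E" for s t
    using conn_mono[OF order_refl EF(1) that] .
  have liftF': "(s, t) \<in> conn (V - {v}) F'" if "(s, t) \<in> conn (V - {v}) E" for s t
    using conn_mono[OF order_refl EF(2) that] .
  show "(p, q) \<in> conn (V - {v}) F'"
  proof (cases "(p, q) \<in> F'")
    case True
    then show ?thesis using pq by (intro conn_edge) auto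
  next
    case False
    then have pq': "p = x \<and> q = u \<or> p = u \<and> q = x"
      using FF' pq by blast
    then have v: "v \<noteq> x" "v \<noteq> u" using pq by auto
    have "(x, u) \<in> conn (V - {v}) F'"
    proof (cases "(x, v) \<in> conn (V - {u}) E")
      case False
      then have "(x, u) \<in> conn (V - {v}) E"
        using x u v by (intro conn_to_deleted) auto
      then show ?thesis by (rule liftF')
    next
      case True
      then have "(x, v) \<in> conn (V - {u}) F"
        by (rule liftF)
      then have "(w, v) \<notin> conn (V - {u}) F"
        using xw conn_sym[of w v "V - {u}" F] conn_trans[of x v "V - {u}" F w] by blast
      then have wv: "w \<noteq> v" "(w, v) \<notin> conn (V - {u}) E"
        using liftF[of w v] conn_refl[OF w, of F] by blast+
      then have "(w, u) \<in> conn (V - {v}) E"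
        using w u v by (intro conn_to_deleted) auto
      then have "(w, u) \<in> conn (V - {v}) F'"
        by (rule liftF')
      moreover have "(x, w) \<in> conn (V - {v}) F'"
        using x w v wv xwF' by (intro conn_edge) auto
      ultimately show ?thesis
        using conn_trans[of x w "V - {v}" F' u] by blast
    qed
    then show ?thesis
      using pq' conn_sym[of x u "V - {v}" F'] by blast
  qed
qed

text \<open>\<open>xy'\<close> and \<open>yx'\<close> replace \<open>xx'\<close> and
  \<open>yy'\<close>; \<open>F0\<close> stands for the edges apart from the redundant copy of
  \<open>xx'\<close>. For \<open>v = u\<close> the bypass of \<open>xx'\<close> survives. Any other
  \<open>v\<close> misses one of the two components: there the old edge is bypassed through
  \<open>u\<close>, and the other old edge by both new edges together with that bypass.\<close>

lemma conn_swap_ends: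
  assumes u: "u \<in> V" and xy: "{x, x', y, y'} \<subseteq> V - {u}"
    and sep: "(x, y) \<notin> conn (V - {u}) F"
    and red: "(x, x') \<in> conn (V - {u}) F0"
    and edges: "(x, x') \<in> F" "(y, y') \<in> F" "(x, y') \<in> F'" "(y, x') \<in> F'"
    and sub: "E \<subseteq> F" "E \<subseteq> F'" "F \<subseteq> F' \<union> {(x, x'), (y, y')}" "F0 \<subseteq> F" "F0 \<subseteq> F' \<union> {(y, y')}"
    and v: "v \<in> V" and ab: "(a, b) \<in> conn (V - {v}) F"
  shows "(a, b) \<in> conn (V - {v}) F'"
  using ab
proof (rule conn_subset)
  have liftF: "(s, t) \<in> conn (V - {u}) F" if "(s, t) \<in> conn (V - {u}) E" for s t
    using conn_mono[OF order_refl sub(1) that] .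
  have liftF': "(s, t) \<in> conn (V - {v}) F'" if "(s, t) \<in> conn (V - {v}) E" for s t
    using conn_mono[OF order_refl sub(2) that] .
  have xx': "(x, x') \<in> conn (V - {u}) F" and yy': "(y, y') \<in> conn (V - {u}) F"
    using xy edges by (auto intro!: conn_edge)
  have sep': "(x, y') \<notin> conn (V - {u}) F"
    using sep yy' conn_sym[of y y' "V - {u}" F] conn_trans[of x y' "V - {u}" F y] by blast
  have new: "(x, y') \<in> conn (V - {v}) F'" if "v \<noteq> x" "v \<noteq> y'"
    using that xy edges by (intro conn_edge) auto
  have new': "(y, x') \<in> conn (V - {v}) F'" if "v \<noteq> y" "v \<noteq> x'"
    using that xy edges by (intro conn_edge) auto
  have old: "((v \<noteq> x \<and> v \<noteq> x') \<longrightarrow> (x, x') \<in> conn (V - {v}) F') \<and>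
      ((v \<noteq> y \<and> v \<noteq> y') \<longrightarrow> (y, y') \<in> conn (V - {v}) F')"
  proof (cases "v = u")
    case True
    have "(x, x') \<in> conn (V - {u}) F'"
      using red
    proof (rule conn_within)
      fix p q assume pq: "(x, p) \<in> conn (V - {u}) F0" "(x, q) \<in> conn (V - {u}) F0" "(p, q) \<in> F0"
      then have "(x, p) \<in> conn (V - {u}) F"
        using conn_mono[OF order_refl sub(4)] by blast
      \<comment> \<open>The bypass of \<open>xx'\<close> stays in the component of \<open>x\<close>,
        so it avoids \<open>yy'\<close>, the only edge of \<open>F0\<close> that \<open>F'\<close>
        may lack.\<close>
      then have "(p, q) \<noteq> (y, y')" using sep by blast
      then show "p \<in> V - {u} \<and> q \<in> V - {u} \<and> (p, q) \<in> F'"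
        using pq sub(5) conn_in[of x p "V - {u}" F0] conn_in[of x q "V - {u}" F0] by blast
    qed (use xy in auto)
    moreover have "(x, y') \<in> conn (V - {u}) F'" "(y, x') \<in> conn (V - {u}) F'"
      using True new new' xy by auto
    ultimately show ?thesis
      using True conn_trans[of y x' "V - {u}" F' x] conn_trans[of y x "V - {u}" F' y']
        conn_sym[of x x' "V - {u}" F'] by blast
  next
    case vu: False
    show ?thesis
    proof (cases "(x, v) \<in> conn (V - {u}) F")
      case True
      have "(y, v) \<notin> conn (V - {u}) F" "(y', v) \<notin> conn (V - {u}) F"
        using True sep sep' conn_sym[of y v "V - {u}" F] conn_sym[of y' v "V - {u}" F]
          conn_trans[of x v "V - {u}" F y] conn_trans[of x v "V - {u}" F y'] by blast+
      then have yv: "y \<noteq> v" "y' \<noteq> v" "(y, v) \<notin> conn (V - {u}) E" "(y', v) \<notin> conn (V - {u}) E"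
        using liftF[of y v] liftF[of y' v] xy conn_refl[of y "V - {u}" F] conn_refl[of y' "V - {u}" F]
        by auto
      have "(y, u) \<in> conn (V - {v}) E" "(y', u) \<in> conn (V - {v}) E"
        by (rule conn_to_deleted; use xy u vu yv in auto)+
      then have "(y, y') \<in> conn (V - {v}) E"
        using conn_sym[of y' u "V - {v}" E] conn_trans[of y u "V - {v}" E y'] by blast
      then have *: "(y, y') \<in> conn (V - {v}) F'"
        by (rule liftF')
      \<comment> \<open>Route: a new edge from \<open>x\<close> to \<open>y'\<close>, the bypass to
        \<open>y\<close>, the other new edge to \<open>x'\<close>.\<close>
      have "(x, x') \<in> conn (V - {v}) F'" if "v \<noteq> x" "v \<noteq> x'"
        using conn_trans[OF conn_trans[OF new conn_sym[OF *]] new'] that yv by metis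
      then show ?thesis using * by blast
    next
      case False
      then have "(x', v) \<notin> conn (V - {u}) F"
        using xx' conn_trans[of x x' "V - {u}" F v] by blast
      then have xv: "x \<noteq> v" "x' \<noteq> v" "(x, v) \<notin> conn (V - {u}) E" "(x', v) \<notin> conn (V - {u}) E"
        using False liftF[of x v] liftF[of x' v] xy conn_refl[of x "V - {u}" F]
          conn_refl[of x' "V - {u}" F]
        by auto
      have "(x, u) \<in> conn (V - {v}) E" "(x', u) \<in> conn (V - {v}) E"
        by (rule conn_to_deleted; use xy u vu xv in auto)+
      then have "(x, x') \<in> conn (V - {v}) E"
        using conn_sym[of x' u "V - {v}" E] conn_trans[of x u "V - {v}" E x'] by blast
      then have *: "(x, x') \<in> conn (V - {v}) F'"
        by (rule liftF')
      have "(y, y') \<in> conn (V - {v}) F'" if "v \<noteq> y" "v \<noteq> y'"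
        using conn_trans[OF conn_trans[OF new' conn_sym[OF *]] new] that xv by metis
      then show ?thesis using * by blast
    qed
  qed
  show "(p, q) \<in> conn (V - {v}) F'"
    if "p \<in> V - {v}" "q \<in> V - {v}" "(p, q) \<in> F" for p q
  proof (cases "(p, q) \<in> F'")
    case True
    then show ?thesis using that by (intro conn_edge) auto
  next
    case False
    then show ?thesis
      using that sub(3) old by blast
  qed
qed

section \<open>Families of pairs and the quantity to be maximised\<close>

text \<open>An indexed family, not a set, so that an exchange keeps the number of pairs even if
  pairs coincide or belong to \<open>E\<close>. Ends at cut vertices do not count, as these may be
  shared by several blocks.\<close>

definition touches :: "nat \<Rightarrow> (nat \<Rightarrow> 'a \<times> 'a) \<Rightarrow> bool" where
  "touches k f \<longleftrightarrow> (\<forall>i<k. f i \<in> A \<times> B) \<and>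
    (\<forall>S. pendant_block V E S \<and> non_cut A B E S \<noteq> {} \<longrightarrow>
      (\<exists>i<k. fst (f i) \<in> non_cut A B E S \<or> snd (f i) \<in> non_cut A B E S))"

text \<open>Kept as a set rather than a count, so that an exchange is compared with the old family
  by inclusion.\<close>

definition linked :: "nat \<Rightarrow> (nat \<Rightarrow> 'a \<times> 'a) \<Rightarrow> ('a \<times> 'a \<times> 'a) set" where
  "linked k f = {(v, a, b). v \<in> V \<and> (a, b) \<in> conn (V - {v}) (E \<union> f ` {..<k})}"

lemma linked_subset: "linked k f \<subseteq> V \<times> V \<times> V"
  using conn_in by (fastforce simp: linked_def)

lemma maximally_linked_exists:
  assumes "touches k f0"
  obtains f where "touches k f"
    "\<And>g. touches k g \<Longrightarrow> linked k f \<subseteq> linked k g \<Longrightarrow> linked k g = linked k f"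
proof -
  have fin: "finite (V \<times> V \<times> V)"
    using finite_V by blast
  have "\<forall>g. touches k g \<longrightarrow> card (linked k g) < Suc (card (V \<times> V \<times> V))"
    using card_mono[OF fin linked_subset] by (simp add: less_Suc_eq_le)
  then obtain f where f: "touches k f" "\<forall>g. touches k g \<longrightarrow> card (linked k g) \<le> card (linked k f)"
    using ex_has_greatest_nat[of "touches k" f0 "\<lambda>f. card (linked k f)"] assms by blast
  show ?thesis
  proof (rule that[OF f(1)])
    fix g assume g: "touches k g" "linked k f \<subseteq> linked k g"
    then show "linked k g = linked k f"
      using f(2) finite_subset[OF linked_subset fin] by (intro card_seteq[symmetric]) auto
  qed
qed

section \<open>Consequences of maximality at a vertex \<open>u\<close>\<close>

context
  fixes k :: nat and f :: "nat \<Rightarrow> 'a \<times> 'a" and u :: 'a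
  assumes touches: "touches k f"
    and maximal: "\<And>g. touches k g \<Longrightarrow> linked k f \<subseteq> linked k g \<Longrightarrow> linked k g = linked k f"
    and u: "u \<in> V"
begin

abbreviation F :: "('a \<times> 'a) set" where "F \<equiv> E \<union> f ` {..<k}"

lemma family_edge: "i < k \<Longrightarrow> f i \<in> A \<times> B"
  using touches by (simp add: touches_def)

lemma F_subset: "F \<subseteq> A \<times> B"
  using E_subset family_edge by blast

lemma no_improvement:
  assumes "touches k g"
    and "\<And>v a b. v \<in> V \<Longrightarrow> (a, b) \<in> conn (V - {v}) F \<Longrightarrow> (a, b) \<in> conn (V - {v}) (E \<union> g ` {..<k})"
    and "(a, b) \<in> conn (V - {u}) (E \<union> g ` {..<k})"
  shows "(a, b) \<in> conn (V - {u}) F"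
proof -
  have "linked k f \<subseteq> linked k g"
    using assms(2) by (auto simp: linked_def)
  then have "linked k g = linked k f"
    using maximal assms(1) by blast
  moreover have "(u, a, b) \<in> linked k g"
    using assms(3) u by (simp add: linked_def)
  ultimately show ?thesis
    by (simp add: linked_def)
qed

text \<open>A vertex that separates \<open>F\<close> also separates \<open>E\<close> and is a cut
  vertex; hence moving an end away from it leaves every pendant block touched.\<close>

lemma non_cut_separator:
  assumes "a \<in> V - {u}" "b \<in> V - {u}" "(a, b) \<notin> conn (V - {u}) F"
  shows "u \<notin> non_cut A B E S"
proof -
  have "(a, b) \<notin> conn (V - {u}) E"
    using assms(3) conn_mono[of "V - {u}" "V - {u}" E F a b] by blast
  then show ?thesis
    using assms u cut_vertex_iff[of u] by (auto simp: non_cut_def)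
qed

text \<open>Otherwise replacing \<open>xu\<close> by \<open>xw\<close> would improve the family. The
  condition \<open>side\<close> keeps the new pair in \<open>A \<times> B\<close>.\<close>

lemma end_not_movable:
  assumes i: "i < k" and fi: "f i = (x, u) \<or> f i = (u, x)"
    and x: "x \<in> V - {u}" and w: "w \<in> V - {u}" and side: "u \<in> A \<longleftrightarrow> w \<in> A"
  shows "(x, w) \<in> conn (V - {u}) F"
proof (rule ccontr)
  assume sep: "(x, w) \<notin> conn (V - {u}) F"
  define g where "g = f(i := if f i = (x, u) then (x, w) else (w, x))"
  have gi: "g i = (x, w) \<and> f i = (x, u) \<or> g i = (w, x) \<and> f i = (u, x)"
    using fi by (auto simp: g_def)
  have gother: "g l = f l" if "l \<noteq> i" for l
    using that by (simp add: g_def)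
  have "touches k g"
    unfolding touches_def
  proof (intro conjI allI impI)
    fix l assume l: "l < k"
    have "g i \<in> A \<times> B"
      using gi family_edge[OF i] w side disjoint u by auto
    then show "g l \<in> A \<times> B"
      using family_edge[OF l] gother[of l] by metis
  next
    fix S assume S: "pendant_block V E S \<and> non_cut A B E S \<noteq> {}"
    then obtain l where l: "l < k" "fst (f l) \<in> non_cut A B E S \<or> snd (f l) \<in> non_cut A B E S"
      using touches unfolding touches_def by blast
    have "fst (g l) \<in> non_cut A B E S \<or> snd (g l) \<in> non_cut A B E S"
    proof (cases "l = i")
      case True
      then show ?thesis
        using l gi non_cut_separator[OF x w sep, of S] by auto
    next
      case False
      then show ?thesis using l gother by simp
    qed
    then show "\<exists>l<k. fst (g l) \<in> non_cut A B E S \<or> snd (g l) \<in> non_cut A B E S"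
      using l by blast
  qed
  moreover have sub: "F \<subseteq> (E \<union> g ` {..<k}) \<union> {(x, u), (u, x)}"
  proof
    fix e assume "e \<in> F"
    then consider "e \<in> E" | l where "l < k" "e = f l" by blast
    then show "e \<in> (E \<union> g ` {..<k}) \<union> {(x, u), (u, x)}"
    proof cases
      case 2
      then show ?thesis
        using image_eqI[of "f l" g l "{..<k}"] gother[of l] fi by (cases "l = i") auto
    qed blast
  qed
  have new: "(x, w) \<in> E \<union> g ` {..<k} \<or> (w, x) \<in> E \<union> g ` {..<k}"
    using gi i by force
  have "(a, b) \<in> conn (V - {v}) (E \<union> g ` {..<k})" if "(a, b) \<in> conn (V - {v}) F" for v a b
    by (rule conn_move_end[OF u x w _ _ sep sub new that]) auto
  moreover have "(x, w) \<in> conn (V - {u}) (E \<union> g ` {..<k})"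
    using x w new by (intro conn_edge) auto
  ultimately show False
    using no_improvement[of g x w] sep by blast
qed

text \<open>Given an edge \<open>xu\<close> of the family, all other vertices on the side of
  \<open>u\<close> lie in the component of \<open>x\<close>. A vertex \<open>z\<close> outside that
  component is isolated in \<open>V - {u}\<close>, so the member of the family touching its pendant
  block can only be \<open>zu\<close>. That end is not movable either, which puts \<open>z\<close>
  into the component of \<open>x\<close> as well.\<close>

lemma no_edge_at_separator:
  assumes a: "a \<in> V - {u}" and b: "b \<in> V - {u}" and sep: "(a, b) \<notin> conn (V - {u}) F"
    and i: "i < k"
  shows "fst (f i) \<noteq> u \<and> snd (f i) \<noteq> u"
proof (rule ccontr)
  assume "\<not> ?thesis"
  then obtain x where fi: "f i = (x, u) \<or> f i = (u, x)"
    by (metis prod.collapse)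
  obtain P N where PN: "P = A \<and> N = B \<or> P = B \<and> N = A" and uP: "u \<in> P"
    using u by blast
  have V: "V = P \<union> N" and PNdisj: "P \<inter> N = {}"
    using PN disjoint by auto
  have across: "s \<in> P \<longleftrightarrow> t \<in> N" if "(s, t) \<in> F \<or> (t, s) \<in> F" for s t
    using that F_subset PN disjoint by blast
  have xN: "x \<in> N"
    using fi i across[of u x] uP by force
  then have x: "x \<in> V - {u}"
    using V PNdisj uP by blast
  have P_conn: "(s, w) \<in> conn (V - {u}) F"
    if "j < k" "f j = (s, u) \<or> f j = (u, s)" "s \<in> N" "w \<in> P" "w \<noteq> u" for j s w
    using that uP V PN PNdisj by (intro end_not_movable[of j]) auto
  obtain z where z: "z \<in> V - {u}" "(x, z) \<notin> conn (V - {u}) F"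
    using a b sep conn_sym[of x a "V - {u}" F] conn_trans[of a x "V - {u}" F b] by blast
  have zN: "z \<in> N"
    using z P_conn[OF i fi xN, of z] V by blast
  have isolated: "t = u" if t: "t \<in> V" "(z, t) \<in> F \<or> (t, z) \<in> F" for t
  proof (rule ccontr)
    assume tu: "t \<noteq> u"
    have "t \<in> P"
      using across[of t z] t zN by blast
    then have "(x, t) \<in> conn (V - {u}) F"
      using P_conn[OF i fi xN] tu by blast
    moreover have "(t, z) \<in> conn (V - {u}) F"
      using t tu z by (intro conn_edge) auto
    ultimately show False
      using z conn_trans[of x t "V - {u}" F z] by blast
  qed
  have comp: "t = z" if "(z, t) \<in> conn (V - {u}) E" for t
  proof -
    have "t \<in> {z}"
      using that by (rule conn_closed) (use isolated in auto)
    then show ?thesis by simp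
  qed
  have "(z, x) \<notin> conn (V - {u}) E"
    using comp[of x] z conn_refl[of z "V - {u}" F] by blast
  then obtain S where S: "pendant_block V E S" "non_cut A B E S \<noteq> {}"
    "non_cut A B E S \<subseteq> conn (V - {u}) E `` {z}"
    using pendant_block_in_component[OF u z(1) x] by blast
  then have "non_cut A B E S = {z}"
    using comp by blast
  then obtain j where j: "j < k" "fst (f j) = z \<or> snd (f j) = z"
    using touches S unfolding touches_def by (metis singletonD)
  then obtain t where t: "f j = (z, t) \<or> f j = (t, z)"
    by (metis prod.collapse)
  have "t \<in> V"
    using t family_edge[OF j(1)] by auto
  then have "t = u"
    using isolated[of t] t j by force
  then have fj: "f j = (z, u) \<or> f j = (u, z)"
    using t by blast
  \<comment> \<open>A second vertex on the side of \<open>u\<close>, available because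
    \<open>A\<close> and \<open>B\<close> have at least two elements each.\<close>
  obtain w where w: "w \<in> P" "w \<noteq> u"
  proof -
    have "P \<noteq> {u}" using PN card_A card_B by auto
    then show ?thesis using uP that by blast
  qed
  have "(x, w) \<in> conn (V - {u}) F" "(z, w) \<in> conn (V - {u}) F"
    using P_conn[OF i fi xN w] P_conn[OF j(1) fj zN w] by auto
  then show False
    using z conn_sym[of z w "V - {u}" F] conn_trans[of x w "V - {u}" F z] by blast
qed

text \<open>By \<open>many\<close>, \<open>k\<close> irredundant pairs would leave at most one
  component; this forces a redundant pair and thereby the second exchange.\<close>

lemma not_separated:
  assumes many: "card (components (V - {u}) E) \<le> k + 1"
    and a: "a \<in> V - {u}" and b: "b \<in> V - {u}"
  shows "(a, b) \<in> conn (V - {u}) F"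
proof (rule ccontr)
  assume sep: "(a, b) \<notin> conn (V - {u}) F"
  have fV: "fst (f i) \<in> V - {u} \<and> snd (f i) \<in> V - {u}" if "i < k" for i
    using no_edge_at_separator[OF a b sep that] family_edge[OF that] by auto
  have "\<exists>i<k. f i \<in> conn (V - {u}) (E \<union> f ` ({..<k} - {i}))"
  proof (rule ccontr)
    assume "\<not> ?thesis"
    then have "card (components (V - {u}) F) + card {..<k} \<le> card (components (V - {u}) E)"
      using fV finite_V by (intro card_components_irredundant) auto
    then have "card (components (V - {u}) F) \<le> 1"
      using many by simp
    then show False
      using sep a b finite_V card_components_le_1_iff[of "V - {u}" F] by blast
  qed
  then obtain i where i: "i < k" "f i \<in> conn (V - {u}) (E \<union> f ` ({..<k} - {i}))" by blast
  obtain x x' where fi: "f i = (x, x')" by force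
  have x: "x \<in> V - {u}" "x' \<in> V - {u}"
    using fV[OF i(1)] fi by auto
  obtain z where z: "z \<in> V - {u}" "(x, z) \<notin> conn (V - {u}) F"
    using a b sep conn_sym[of x a "V - {u}" F] conn_trans[of a x "V - {u}" F b] by blast
  have EF: "(s, t) \<in> conn (V - {u}) F" if "(s, t) \<in> conn (V - {u}) E" for s t
    using that by (rule conn_mono[rotated -1]) auto
  have "(z, x) \<notin> conn (V - {u}) E"
    using z(2) EF conn_sym[of z x "V - {u}" F] by blast
  then obtain S where S: "pendant_block V E S" "non_cut A B E S \<noteq> {}"
    "non_cut A B E S \<subseteq> conn (V - {u}) E `` {z}"
    using pendant_block_in_component[OF u z(1) x(1)] by blast
  then obtain j where j: "j < k" "fst (f j) \<in> non_cut A B E S \<or> snd (f j) \<in> non_cut A B E S"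
    using touches unfolding touches_def by blast
  obtain y y' where fj: "f j = (y, y')" by force
  have y: "y \<in> V - {u}" "y' \<in> V - {u}"
    using fV[OF j(1)] fj by auto
  have yy': "(y, y') \<in> conn (V - {u}) F"
    using y fj j(1) by (intro conn_edge) (auto intro: rev_image_eqI)
  have "(z, y) \<in> conn (V - {u}) F \<or> (z, y') \<in> conn (V - {u}) F"
    using j S(3) fj EF by auto
  then have sep_y: "(x, y) \<notin> conn (V - {u}) F"
    using z(2) yy' conn_sym[of z _ "V - {u}" F] conn_trans[of x _ "V - {u}" F] by blast
  then have sep_y': "(x, y') \<notin> conn (V - {u}) F"
    using yy' conn_sym[of y y' "V - {u}" F] conn_trans[of x y' "V - {u}" F y] by blast
  have xx': "(x, x') \<in> conn (V - {u}) F"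
    using x fi i(1) by (intro conn_edge) (auto intro: rev_image_eqI)
  \<comment> \<open>\<open>x'\<close> lies in the component of \<open>x\<close> and
    \<open>y'\<close> does not. With equal indices the second update in \<open>g\<close> would
    overwrite the first.\<close>
  have ij: "i \<noteq> j"
    using fi fj sep_y' xx' by auto
  define g where "g = f(i := (x, y'), j := (y, x'))"
  have gi: "g i = (x, y')" and gj: "g j = (y, x')"
    and gother: "\<And>l. l \<noteq> i \<Longrightarrow> l \<noteq> j \<Longrightarrow> g l = f l"
    using ij by (auto simp: g_def)
  let ?G = "E \<union> g ` {..<k}"
  have "touches k g"
    unfolding touches_def
  proof (intro conjI allI impI)
    fix l assume l: "l < k"
    then show "g l \<in> A \<times> B"
      using family_edge[OF i(1)] family_edge[OF j(1)] family_edge[OF l] gi gj gother[of l] fi fj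
      by (cases "l = i"; cases "l = j") auto
  next
    fix T assume "pendant_block V E T \<and> non_cut A B E T \<noteq> {}"
    then obtain l where l: "l < k" "fst (f l) \<in> non_cut A B E T \<or> snd (f l) \<in> non_cut A B E T"
      using touches unfolding touches_def by blast
    show "\<exists>l<k. fst (g l) \<in> non_cut A B E T \<or> snd (g l) \<in> non_cut A B E T"
    proof (cases "l = i \<or> l = j")
      \<comment> \<open>The exchange only redistributes the four ends over the indices
        \<open>i\<close> and \<open>j\<close>, so every block touched there stays touched.\<close>
      case True
      then have "x \<in> non_cut A B E T \<or> y' \<in> non_cut A B E T \<or>
          y \<in> non_cut A B E T \<or> x' \<in> non_cut A B E T"
        using l fi fj by auto
      then show ?thesis
        using gi gj i(1) j(1) by (metis fst_conv snd_conv)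
    next
      case False
      then show ?thesis using l gother by metis
    qed
  qed
  moreover have "(p, q) \<in> conn (V - {v}) ?G" if "v \<in> V" "(p, q) \<in> conn (V - {v}) F" for v p q
  proof (rule conn_swap_ends[OF u _ sep_y _ _ _ _ _ _ _ _ _ _ that])
    show "{x, x', y, y'} \<subseteq> V - {u}" using x y by simp
    show "(x, x') \<in> conn (V - {u}) (E \<union> f ` ({..<k} - {i}))"
      using i(2) fi by simp
    show "(x, x') \<in> F" "(y, y') \<in> F" "(x, y') \<in> ?G" "(y, x') \<in> ?G"
      using i(1) j(1) fi fj gi gj by (force intro: rev_image_eqI)+
    have in_G: "f l \<in> ?G" if "l < k" "l \<noteq> i" "l \<noteq> j" for l
      using image_eqI[of "f l" g l "{..<k}"] gother[of l] that by simp
    show "F \<subseteq> ?G \<union> {(x, x'), (y, y')}"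
      using in_G fi fj by blast
    show "E \<union> f ` ({..<k} - {i}) \<subseteq> ?G \<union> {(y, y')}"
      using in_G fj by blast
  qed auto
  moreover have "(x, y') \<in> conn (V - {u}) ?G"
    using x y gi i(1) by (intro conn_edge) (auto intro: rev_image_eqI)
  ultimately show False
    using no_improvement[of g x y'] sep_y' by blast
qed

end

section \<open>A touching family from a maximum matching\<close>

text \<open>\<open>type_A\<close> and \<open>type_B\<close> hold vacuously for a block without
  non-cut vertices, hence the escape clauses; \<open>a0\<close> and \<open>b0\<close> then supply an
  arbitrary end.\<close>

lemma touching_edge:
  assumes "type_A A B E S \<or> type_AB A B E S" "type_B A B E T \<or> type_AB A B E T"
  obtains e where "e \<in> A \<times> B" "non_cut A B E S = {} \<or> fst e \<in> non_cut A B E S"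
    "non_cut A B E T = {} \<or> snd e \<in> non_cut A B E T"
proof -
  obtain a0 b0 where "a0 \<in> A" "b0 \<in> B"
    using card_A card_B by (metis card.empty ex_in_conv not_numeral_le_zero)
  then obtain a b where "a \<in> A" "non_cut A B E S = {} \<or> a \<in> non_cut A B E S"
    "b \<in> B" "non_cut A B E T = {} \<or> b \<in> non_cut A B E T"
    using assms unfolding type_A_def type_B_def type_AB_def by blast
  then show ?thesis using that[of "(a, b)"] by simp
qed

lemma legal_pair_edge:
  assumes "q \<in> legal_pairs A B E"
  shows "\<exists>e\<in>A \<times> B. \<forall>S\<in>q. non_cut A B E S = {} \<or> fst e \<in> non_cut A B E S \<or> snd e \<in> non_cut A B E S"
proof -
  obtain S T where "q = {S, T}" "type_A A B E S \<or> type_AB A B E S" "type_B A B E T \<or> type_AB A B E T"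
    using assms unfolding legal_pairs_def by (smt (verit) insert_commute mem_Collect_eq)
  then show ?thesis
    using touching_edge[of S T] by (metis insert_iff singletonD)
qed

lemma pendant_block_edge:
  assumes "pendant_block V E S"
  shows "\<exists>e\<in>A \<times> B. non_cut A B E S = {} \<or> fst e \<in> non_cut A B E S \<or> snd e \<in> non_cut A B E S"
proof -
  have "non_cut A B E S \<subseteq> A \<union> B"
    using pendant_block_subset[OF assms] by (auto simp: non_cut_def)
  then consider "non_cut A B E S = {}" | a where "a \<in> A" "a \<in> non_cut A B E S"
    | b where "b \<in> B" "b \<in> non_cut A B E S" by blast
  moreover obtain a0 b0 where "a0 \<in> A" "b0 \<in> B"
    using card_A card_B by (metis card.empty ex_in_conv not_numeral_le_zero)
  ultimately show ?thesis
    by cases (metis SigmaI fst_conv snd_conv)+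
qed

lemma card_matched:
  assumes "legal_matching A B E \<Lambda> M"
  shows "card (\<Union>M) = 2 * card M"
proof -
  have two: "card q = 2" "finite q" if "q \<in> M" for q
  proof -
    have "q \<in> legal_pairs A B E"
      using that assms by (auto simp: legal_matching_def)
    then obtain S T where "q = {S, T}" "S \<noteq> T"
      unfolding legal_pairs_def by blast
    then show "card q = 2" "finite q" by simp_all
  qed
  have "disjnt q q'" if "q \<in> M" "q' \<in> M" "q \<noteq> q'" for q q'
    using that assms unfolding legal_matching_def disjnt_def by blast
  then have "card (\<Union>M) = (\<Sum>q\<in>M. card q)"
    using two by (intro card_Union_disjoint) (auto simp: pairwise_def)
  then show ?thesis using two by simp
qed

text \<open>One pair for each legal pair of a maximum matching and one for each unmatched block:
  with a matching of size \<open>m\<close> these are at most \<open>m + (|\<Lambda>| - 2m)\<close>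
  pairs.\<close>

lemma touching_set_exists:
  obtains L where "L \<subseteq> A \<times> B" "finite L"
    "card L + matching_number A B E (pendant_blocks A B E) \<le> card (pendant_blocks A B E)"
    "\<And>S. pendant_block V E S \<Longrightarrow> non_cut A B E S \<noteq> {} \<Longrightarrow>
      \<exists>e\<in>L. fst e \<in> non_cut A B E S \<or> snd e \<in> non_cut A B E S"
proof -
  let ?\<Lambda> = "pendant_blocks A B E"
  let ?t = "\<lambda>S e. non_cut A B E S = {} \<or> fst e \<in> non_cut A B E S \<or> snd e \<in> non_cut A B E S"
  obtain M where M: "legal_matching A B E ?\<Lambda> M" and cM: "card M = matching_number A B E ?\<Lambda>"
    using maximum_matching_exists by blast
  have M_legal: "M \<subseteq> legal_pairs A B E"
    using M by (simp add: legal_matching_def)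
  then have finM: "finite M"
    by (rule finite_subset[OF _ finite_legal_pairs])
  have "\<forall>q\<in>M. \<exists>e. e \<in> A \<times> B \<and> (\<forall>S\<in>q. ?t S e)"
  proof
    fix q assume "q \<in> M"
    then show "\<exists>e. e \<in> A \<times> B \<and> (\<forall>S\<in>q. ?t S e)"
      using M_legal legal_pair_edge[of q] unfolding Bex_def by blast
  qed
  then obtain p where p: "\<forall>q\<in>M. p q \<in> A \<times> B \<and> (\<forall>S\<in>q. ?t S (p q))"
    by (rule bchoice[THEN exE])
  have "\<forall>S\<in>?\<Lambda>. \<exists>e. e \<in> A \<times> B \<and> ?t S e"
  proof
    fix S assume "S \<in> ?\<Lambda>"
    then have "pendant_block V E S" by (simp add: pendant_blocks_eq)
    then show "\<exists>e. e \<in> A \<times> B \<and> ?t S e"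
      by (rule pendant_block_edge[unfolded Bex_def])
  qed
  then obtain s where s: "\<forall>S\<in>?\<Lambda>. s S \<in> A \<times> B \<and> ?t S (s S)"
    by (rule bchoice[THEN exE])
  have UM: "\<Union>M \<subseteq> ?\<Lambda>"
    using M unfolding legal_matching_def by blast
  define L where "L = p ` M \<union> s ` (?\<Lambda> - \<Union>M)"
  show ?thesis
  proof (rule that[of L])
    show "L \<subseteq> A \<times> B"
      using p s unfolding L_def by blast
    show "finite L"
      using finM finite_pendant_blocks unfolding L_def by blast
    have "card L \<le> card (p ` M) + card (s ` (?\<Lambda> - \<Union>M))"
      unfolding L_def by (rule card_Un_le)
    also have "\<dots> \<le> card M + card (?\<Lambda> - \<Union>M)"
      using finM finite_pendant_blocks by (intro add_mono card_image_le) auto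
    also have "card (?\<Lambda> - \<Union>M) = card ?\<Lambda> - 2 * card M"
      using UM finite_pendant_blocks finite_subset card_matched[OF M]
      by (subst card_Diff_subset) auto
    finally show "card L + matching_number A B E ?\<Lambda> \<le> card ?\<Lambda>"
      using card_mono[OF finite_pendant_blocks UM] card_matched[OF M] cM by linarith
    fix S assume S: "pendant_block V E S" "non_cut A B E S \<noteq> {}"
    then have S\<Lambda>: "S \<in> ?\<Lambda>" by (simp add: pendant_blocks_eq)
    show "\<exists>e\<in>L. fst e \<in> non_cut A B E S \<or> snd e \<in> non_cut A B E S"
    proof (cases "S \<in> \<Union>M")
      case True
      then obtain q where "q \<in> M" "S \<in> q" by blast
      then show ?thesis using p S(2) unfolding L_def by blast
    next
      case False
      then show ?thesis using s S(2) S\<Lambda> unfolding L_def by blast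
    qed
  qed
qed

lemma touching_family_exists:
  assumes "card (pendant_blocks A B E) \<le> k + matching_number A B E (pendant_blocks A B E)"
  obtains f where "touches k f"
proof -
  obtain L where L: "L \<subseteq> A \<times> B" "finite L"
    "card L + matching_number A B E (pendant_blocks A B E) \<le> card (pendant_blocks A B E)"
    "\<And>S. pendant_block V E S \<Longrightarrow> non_cut A B E S \<noteq> {} \<Longrightarrow>
      \<exists>e\<in>L. fst e \<in> non_cut A B E S \<or> snd e \<in> non_cut A B E S"
    using touching_set_exists by blast
  obtain h where h: "bij_betw h {0..<card L} L"
    using ex_bij_betw_nat_finite[OF L(2)] by blast
  obtain a0 b0 where ab: "a0 \<in> A" "b0 \<in> B"
    using card_A card_B by (metis card.empty ex_in_conv not_numeral_le_zero)
  define f where "f i = (if i < card L then h i else (a0, b0))" for i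
  have hL: "h i \<in> L" if "i < card L" for i
    using bij_betwE[OF h] that by simp
  have fAB: "f i \<in> A \<times> B" for i
    using hL[of i] L(1) ab by (auto simp: f_def)
  have onto: "\<exists>i<k. f i = e" if "e \<in> L" for e
  proof -
    have "e \<in> h ` {0..<card L}"
      using that h by (simp add: bij_betw_def)
    then obtain i where "i < card L" "h i = e" by auto
    then show ?thesis using L(3) assms by (intro exI[of _ i]) (simp add: f_def)
  qed
  have "touches k f"
    unfolding touches_def using fAB L(4) onto by metis
  then show ?thesis by (rule that)
qed

lemma biconnector_exists:
  assumes "\<And>u. u \<in> V \<Longrightarrow> vertex_split V E u \<le> k + 1"
    and "card (pendant_blocks A B E) \<le> k + matching_number A B E (pendant_blocks A B E)"
  obtains L where "biconnector A B E L" "card L \<le> k"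
proof -
  obtain f0 where "touches k f0"
    using touching_family_exists assms(2) by blast
  then obtain f where f: "touches k f"
    "\<And>g. touches k g \<Longrightarrow> linked k f \<subseteq> linked k g \<Longrightarrow> linked k g = linked k f"
    using maximally_linked_exists by blast
  define L where "L = f ` {..<k} - E"
  have fAB: "f ` {..<k} \<subseteq> A \<times> B"
    using f(1) by (auto simp: touches_def)
  have "block V (E \<union> f ` {..<k}) V"
  proof (rule block_whole_if_not_separated)
    show "card V \<ge> 3" using card_V by simp
    show "(x, x) \<notin> E \<union> f ` {..<k}" for x
      using no_loop[OF fAB] .
    fix v x y assume "v \<in> V" "x \<in> V - {v}" "y \<in> V - {v}"
    then show "(x, y) \<in> conn (V - {v}) (E \<union> f ` {..<k})"
      using f assms(1)[of v] by (intro not_separated) (simp_all add: vertex_split_eq)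
  qed
  then have "biconnector A B E L"
    using fAB componentwise_biconnected_iff[of L]
    by (auto simp: biconnector_def L_def)
  moreover have "card L \<le> card (f ` {..<k})"
    unfolding L_def by (intro card_mono) auto
  then have "card L \<le> k"
    using card_image_le[of "{..<k}" f] by simp
  ultimately show ?thesis by (rule that)
qed

section \<open>Comparing \<open>eta\<close> with the size of biconnectors\<close>

lemma biconnector_empty: "block V E V \<Longrightarrow> biconnector A B E {}"
  using componentwise_biconnected_iff[of "{}"] by (simp add: biconnector_def)

lemma non_block_components_eq: "non_block_components V E = (if block V E V then 0 else 1)"
proof -
  have "{X \<in> {V}. \<not> block V E X} = (if block V E V then {} else {V})" by auto
  then show ?thesis
    by (simp add: non_block_components_def components_connected[OF connected])
qed

text \<open>The residue subtracts twice the matching number, so the second term of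
  \<open>eta\<close> is \<open>|\<Lambda>|\<close> minus the matching number; this passes from
  integers to natural numbers.\<close>

lemma eta_le_iff:
  "eta A B E \<le> int k \<longleftrightarrow>
    (\<forall>u\<in>V. int (vertex_split V E u) + int (non_block_components V E) - 2 \<le> int k) \<and>
    card (pendant_blocks A B E) \<le> k + matching_number A B E (pendant_blocks A B E)"
proof -
  have "V \<noteq> {}" using card_V by auto
  then have "(MAX u\<in>V. int (vertex_split V E u) + int (non_block_components V E) - 2) \<le> int k \<longleftrightarrow>
      (\<forall>u\<in>V. int (vertex_split V E u) + int (non_block_components V E) - 2 \<le> int k)"
    using finite_V by (subst Max_le_iff) auto
  moreover have "int (matching_number A B E (pendant_blocks A B E)) + residue A B E (pendant_blocks A B E) \<le> int k
    \<longleftrightarrow> card (pendant_blocks A B E) \<le> k + matching_number A B E (pendant_blocks A B E)"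
    by (auto simp: residue_def)
  ultimately show ?thesis
    by (simp only: eta_def max.bounded_iff)
qed

text \<open>A matching covers twice its size in pendant blocks, so the second argument of the
  maximum is nonnegative even where the first is \<open>-1\<close>.\<close>

lemma eta_nonneg: "0 \<le> eta A B E"
proof -
  obtain M where M: "legal_matching A B E (pendant_blocks A B E) M"
    "card M = matching_number A B E (pendant_blocks A B E)"
    using maximum_matching_exists by blast
  have "\<Union>M \<subseteq> pendant_blocks A B E"
    using M(1) unfolding legal_matching_def by blast
  then have "2 * card M \<le> card (pendant_blocks A B E)"
    using card_matched[OF M(1)] card_mono[OF finite_pendant_blocks] by metis
  then show ?thesis
    using M(2) by (simp add: eta_def residue_def)
qed

lemma eta_le_biconnector:
  assumes "biconnector A B E L"
  shows "eta A B E \<le> int (card L)"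
proof -
  have L: "L \<subseteq> A \<times> B" and blk: "block V (E \<union> L) V"
    using assms componentwise_biconnected_iff[of L] by (auto simp: biconnector_def)
  have "int (vertex_split V E u) + int (non_block_components V E) - 2 \<le> int (card L)" if "u \<in> V" for u
    using vertex_split_le[OF L blk that] by (simp add: non_block_components_eq)
  then show ?thesis
    using card_pendant_blocks_le[OF L blk] by (simp add: eta_le_iff)
qed

lemma optimal_biconnector_exists:
  obtains L where "biconnector A B E L" "int (card L) \<le> eta A B E"
proof (cases "block V E V")
  case True
  then show ?thesis
    using that[of "{}"] biconnector_empty eta_nonneg by simp
next
  \<comment> \<open>Now the only component is not a block, so the first term of \<open>eta\<close>
    reads \<open>vertex_split V E u - 1\<close>, matching the assumption of
    \<open>biconnector_exists\<close>.\<close>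
  case False
  define k where "k = nat (eta A B E)"
  have k: "int k = eta A B E"
    using eta_nonneg by (simp add: k_def)
  then have "eta A B E \<le> int k" by simp
  then have bounds: "\<forall>u\<in>V. int (vertex_split V E u) + 1 - 2 \<le> int k"
    "card (pendant_blocks A B E) \<le> k + matching_number A B E (pendant_blocks A B E)"
    using False by (simp_all add: eta_le_iff non_block_components_eq)
  have "vertex_split V E u \<le> k + 1" if "u \<in> V" for u
    using bspec[OF bounds(1) that] by linarith
  then obtain L where "biconnector A B E L" "card L \<le> k"
    using biconnector_exists[of k] bounds(2) by blast
  then show ?thesis
    using that k by (metis of_nat_mono)
qed

lemma min_biconnector_size_eq_eta: "int (min_biconnector_size A B E) = eta A B E"
proof (rule antisym)
  obtain L where L: "biconnector A B E L" "int (card L) \<le> eta A B E"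
    using optimal_biconnector_exists by blast
  have "min_biconnector_size A B E \<le> card L"
    unfolding min_biconnector_size_def using L(1) by (intro Least_le) blast
  then show "int (min_biconnector_size A B E) \<le> eta A B E"
    using L(2) by linarith
  \<comment> \<open>\<open>L\<close> witnesses that the \<open>LEAST\<close> is attained, so the
    lower bound applies to it.\<close>
  have "\<exists>L'. biconnector A B E L' \<and> card L' = min_biconnector_size A B E"
    unfolding min_biconnector_size_def
    by (rule LeastI_ex) (use L(1) in blast)
  then show "eta A B E \<le> int (min_biconnector_size A B E)"
    using eta_le_biconnector by metis
qed

end

theorem theorem1:
  fixes A B :: "'a set" and E :: "('a \<times> 'a) set"
  assumes "bipartite_graph A B E"
    and "connected_graph (A \<union> B) E"
    and "card A \<ge> 2"
    and "card B \<ge> 2"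
  shows "int (min_biconnector_size A B E) = eta A B E \<and>
    eta A B E =
      max (MAX u\<in>A \<union> B. int (vertex_split (A \<union> B) E u) + int (non_block_components (A \<union> B) E) - 2)
          (int (matching_number A B E (pendant_blocks A B E))
             + residue A B E (pendant_blocks A B E))"
proof -
  interpret bipartite_connected A B E
    using assms by unfold_locales
  show ?thesis
    using min_biconnector_size_eq_eta by (simp add: eta_def)
qed

end
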